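(* The function $$u=\ln\bigl(t+b(z)\bigr)+\ln\bigl(t+\bar b(\bar z)\bigr)-2\ln(z\bar z+1)$$ is a solution of the heavenly equation $u_{z\bar z}=\kappa(e^u)_{tt}$ with $\kappa=-1$ for an arbitrary holomorphic function $b(z)$. This solution is a non-invariant solution of this equation if and only if $b(z)$ does not coincide with any of the 8 forms 1–8 listed in the context, taken with the change of notation $$\lambda\mapsto\tilde\lambda=-\frac{\lambda}{2C_1},\quad C_2\mapsto\tilde C_2=C_2-\frac{\lambda^2}{4C_1},\quad \nu\mapsto\tilde\nu=\sqrt{-\frac{\tilde C_2}{C_1}},\quad \gamma\mapsto\tilde\gamma=\frac{\beta}{2\sqrt{-C_1\tilde C_2}}$$ in the forms 1, 2, 3, 4, and $C_1\mapsto-\lambda$ in the form 5. Those 8 choices of $b(z)$ give invariant solutions with respect to the corresponding symmetry generators listed in the context with the same change of notation.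
   Context: Here $z,\bar z$ are complex conjugate variables, $t$ is real, $\bar b(\bar z)$ is the complex conjugate of $b(z)$, $\alpha,\beta$ are real constants and $C$ is a complex constant. List of forms and generators (as they stand before the change of notation; they are the exceptional forms for the analogous solution with $\kappa=+1$), where $\nu=\sqrt{-C_2/C_1}$, $\gamma=\beta/(2\sqrt{-C_1C_2})$: 1. $b(z)=C\left(\frac{z+\lambda-\nu}{z+\lambda+\nu}\right)^{\gamma}+\frac{\alpha}{\beta}$, $\beta\neq0$, $C_1\neq0$, $C_2\neq0$ (for $\kappa=+1$: $\bar\lambda=-\lambda$, $\bar C_1=-C_1$, $\bar C_2=-C_2$); generator $X=\alpha\partial_t+\beta(t\partial_t+2\partial_u)+C_1[(z+\lambda)^2\partial_z-(\bar z-\lambda)^2\partial_{\bar z}-2(z-\bar z+2\lambda)\partial_u]+C_2(\partial_z-\partial_{\bar z})$. 2. $b(z)=\frac{\alpha}{2\sqrt{-C_1C_2}}\ln\left(\frac{z+\lambda+\nu}{z+\lambda-\nu}\right)+C$ if $\beta=0$, $C_2\neq0$; generator of 1 with $\beta=0$. 3. $b(z)=C\exp\left[-\frac{\beta}{C_1(z+\lambda)}\right]+\frac{\alpha}{\beta}$ if $C_2=0$, $\beta\neq0$; generator of 1 with $C_2=0$. 4. $b(z)=\frac{\alpha}{C_1(z+\lambda)}+C$ if $\beta=0$ and $C_2=0$; generator of 1 with $\beta=0$, $C_2=0$. 5. $b(z)=C(C_1z+C_2)^{\beta/C_1}+\frac{\alpha}{\beta}$ if $C_1\neq0$, $\beta\neq0$;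 generator $X=\alpha\partial_t+\beta(t\partial_t+2\partial_u)+C_1(z\partial_z+\bar z\partial_{\bar z}-2\partial_u)+C_2(\partial_z-\partial_{\bar z})$. 6. $b(z)=Ce^{\frac{\beta}{C_2}z}+\frac{\alpha}{\beta}$ if $C_1=0$, $\beta\neq0$; generator of 5 with $C_1=0$. 7. $b(z)=-\frac{\alpha}{C_2}z+C$ if $C_1=0$, $\beta=0$; generator of 5 with $C_1=0$, $\beta=0$. 8. $b(z)=b=\text{constant}$ if $C_1=\alpha=\beta=0$, $C_2\neq0$; generator $X=\partial_z-\partial_{\bar z}$. If $b=\alpha/\beta$, then also the generator $X=\alpha\partial_t+\beta(t\partial_t+2\partial_u)$. In the change of notation, $\lambda,C_1,C_2$ on the right-hand sides are the constants in the general solution $a(z)=C_1z^2-\lambda z+C_2$, $\bar a(\bar z)=C_2\bar z^2+\lambda\bar z+C_1$ (with $\bar\lambda=-\lambda$, $\bar C_1=C_2$) of the equation $a'+\bar a'=2(\bar za+z\bar a)/(z\bar z+1)$, which the invariance condition imposes on $a$; for $C_1\neq0$ one has $a(z)=C_1(z+\tilde\lambda)^2+\tilde C_2$. The general generator of a one-parameter point symmetry group of the heavenly equation is $X=\alpha\partial_t+\beta(t\partial_t+2\partial_u)+a(z)\partial_z+\bar a(\bar z)\partial_{\bar z}-(a'(z)+\bar a'(\bar z))\partial_u$ with $\alpha,\beta$ real and $a$ holomorphic with complex conjugate $\bar a$. A solution $u=f(z,\bar z,t)$ is invariant with respect to $X$ if $(\alpha+\beta t)f_t+a f_z+\bar a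 f_{\bar z}=2\beta-a'-\bar a'$. It is called invariant if this holds for some $\alpha,\beta,a$ not all zero, and non-invariant otherwise.
   Formalization: The "if and only if" excludes b=(α/λ)ln z+C (α≠0 real, λ≠0 imaginary), which is invariant but not among forms 1–8; for constant b (form 8), the generator ∂_z−∂_z̄, which fails for κ=−1, is replaced by all a=C_1z²−λz+C_2 with λ̄=−λ, C̄_1=C_2, α=β=0. *)

theory Defs
  imports "HOL-Complex_Analysis.Complex_Analysis"
begin

definition wirtinger :: "(complex \<Rightarrow> complex) \<Rightarrow> complex \<Rightarrow> complex" where
  "wirtinger f z =
     (frechet_derivative f (at z) 1 - \<i> * frechet_derivative f (at z) \<i>) / 2"

definition wirtinger_bar :: "(complex \<Rightarrow> complex) \<Rightarrow> complex \<Rightarrow> complex" where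
  "wirtinger_bar f z =
     (frechet_derivative f (at z) 1 + \<i> * frechet_derivative f (at z) \<i>) / 2"

(* A field u(z, zbar, t) is a real-valued function of z and t on an open set W of points (z, t).
   The differentiability clauses guarantee that every derivative in the equation exists. *)
definition heavenly_solution ::
    "real \<Rightarrow> (complex \<times> real) set \<Rightarrow> (complex \<Rightarrow> real \<Rightarrow> real) \<Rightarrow> bool" where
  "heavenly_solution \<kappa> W u \<longleftrightarrow>
     (\<forall>(z, t) \<in> W.
        (\<lambda>(w, s). u w s) differentiable (at (z, t)) \<and>
        (\<lambda>w. wirtinger_bar (\<lambda>v. of_real (u v t)) w) differentiable (at z) \<and>
        deriv (\<lambda>s. exp (u z s)) differentiable (at t) \<and>
        wirtinger (\<lambda>w. wirtinger_bar (\<lambda>v. of_real (u v t)) w) z =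
          of_real (\<kappa> * deriv (deriv (\<lambda>s. exp (u z s))) t))"

(* Invariance of u = f(z, zbar, t) under the generator
     X = alpha d_t + beta (t d_t + 2 d_u) + a d_z + abar d_zbar - (a' + abar') d_u. *)
definition invariant_under ::
    "(complex \<times> real) set \<Rightarrow> (complex \<Rightarrow> real \<Rightarrow> real) \<Rightarrow>
     real \<Rightarrow> real \<Rightarrow> (complex \<Rightarrow> complex) \<Rightarrow> bool" where
  "invariant_under W u \<alpha> \<beta> a \<longleftrightarrow>
     a holomorphic_on (fst ` W) \<and>
     (\<forall>(z, t) \<in> W.
        of_real ((\<alpha> + \<beta> * t) * deriv (u z) t)
          + a z * wirtinger (\<lambda>w. of_real (u w t)) z
          + cnj (a z) * wirtinger_bar (\<lambda>w. of_real (u w t)) z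
        = of_real (2 * \<beta>) - deriv a z - cnj (deriv a z))"

definition noninvariant_solution ::
    "real \<Rightarrow> (complex \<times> real) set \<Rightarrow> (complex \<Rightarrow> real \<Rightarrow> real) \<Rightarrow> bool" where
  "noninvariant_solution \<kappa> W u \<longleftrightarrow>
     heavenly_solution \<kappa> W u \<and>
     \<not> (\<exists>\<alpha> \<beta> a. \<not> (\<alpha> = 0 \<and> \<beta> = 0 \<and> (\<forall>z \<in> fst ` W. a z = 0)) \<and>
          invariant_under W u \<alpha> \<beta> a)"

(* The sum of the two conjugate logarithms is real. Re only matters where t + b z is a negative
   real: there both principal values have imaginary part pi, and Re discards the total 2 pi i. *)
definition sol :: "(complex \<Rightarrow> complex) \<Rightarrow> complex \<Rightarrow> real \<Rightarrow> real" where
  "sol b z t =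
     Re (Ln (of_real t + b z) + Ln (of_real t + cnj (b z)) - 2 * Ln (z * cnj z + 1))"

definition sol_domain :: "complex set \<Rightarrow> (complex \<Rightarrow> complex) \<Rightarrow> (complex \<times> real) set" where
  "sol_domain D b = {(z, t). z \<in> D \<and> of_real t + b z \<noteq> 0}"

(* Reality conditions making a(z) = C1 z^2 - lam z + C2 the general solution of
   a' + abar' = 2 (zbar a + z abar) / (z zbar + 1). *)
definition admissible :: "complex \<Rightarrow> complex \<Rightarrow> complex \<Rightarrow> bool" where
  "admissible C1 lam C2 \<longleftrightarrow> cnj lam = - lam \<and> cnj C1 = C2"

(* lamt and C2t are used only for C1 ~= 0, where
   C1 z^2 - lam z + C2 = C1 (z + lamt)^2 + C2t. *)
definition lamt :: "complex \<Rightarrow> complex \<Rightarrow> complex" where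
  "lamt C1 lam = - lam / (2 * C1)"

definition C2t :: "complex \<Rightarrow> complex \<Rightarrow> complex \<Rightarrow> complex" where
  "C2t C1 lam C2 = C2 - lam\<^sup>2 / (4 * C1)"

(* nu = sqrt (-c/C1) and sigma = sqrt (-C1 c), with the signs of the two roots correlated.
   Independent principal values could differ by a sign, which would turn the generator
   attached to b into one with alpha and beta negated. *)
definition roots :: "complex \<Rightarrow> complex \<Rightarrow> complex \<Rightarrow> complex \<Rightarrow> bool" where
  "roots C1 c \<nu> \<sigma> \<longleftrightarrow> \<nu>\<^sup>2 = - c / C1 \<and> \<sigma>\<^sup>2 = - C1 * c \<and> \<sigma> = C1 * \<nu>"

(* A holomorphic branch of ln g on D; the power g^gamma is then exp (gamma * L). Since exp never
   vanishes, neither does g, so quotients in g have nonzero numerator and denominator on D. *)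
definition log_branch :: "complex set \<Rightarrow> (complex \<Rightarrow> complex) \<Rightarrow> (complex \<Rightarrow> complex) \<Rightarrow> bool" where
  "log_branch D g L \<longleftrightarrow> L holomorphic_on D \<and> (\<forall>z\<in>D. exp (L z) = g z)"

definition form1 where
  "form1 D b (\<alpha>::real) (\<beta>::real) C1 lam C2 \<longleftrightarrow>
     \<beta> \<noteq> 0 \<and> C1 \<noteq> 0 \<and> C2t C1 lam C2 \<noteq> 0 \<and>
     (\<exists>\<nu> \<sigma> L C. roots C1 (C2t C1 lam C2) \<nu> \<sigma> \<and>
        log_branch D (\<lambda>z. (z + lamt C1 lam - \<nu>) / (z + lamt C1 lam + \<nu>)) L \<and>
        (\<forall>z\<in>D. b z = C * exp (of_real \<beta> / (2 * \<sigma>) * L z) + of_real (\<alpha> / \<beta>)))"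

definition form2 where
  "form2 D b (\<alpha>::real) (\<beta>::real) C1 lam C2 \<longleftrightarrow>
     \<beta> = 0 \<and> C1 \<noteq> 0 \<and> C2t C1 lam C2 \<noteq> 0 \<and>
     (\<exists>\<nu> \<sigma> L C. roots C1 (C2t C1 lam C2) \<nu> \<sigma> \<and>
        log_branch D (\<lambda>z. (z + lamt C1 lam + \<nu>) / (z + lamt C1 lam - \<nu>)) L \<and>
        (\<forall>z\<in>D. b z = of_real \<alpha> / (2 * \<sigma>) * L z + C))"

(* Admissibility gives C1 * C2t = |C1|^2 + |lam|^2 / 4, so C2t = 0 is in fact impossible in
   form3 and form4; likewise C1 = 0 forces C2 = 0, which rules out form6 and form7. *)
definition form3 where
  "form3 D b (\<alpha>::real) (\<beta>::real) C1 lam C2 \<longleftrightarrow>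
     \<beta> \<noteq> 0 \<and> C1 \<noteq> 0 \<and> C2t C1 lam C2 = 0 \<and>
     (\<exists>C. \<forall>z\<in>D. z + lamt C1 lam \<noteq> 0 \<and>
        b z = C * exp (- (of_real \<beta> / (C1 * (z + lamt C1 lam)))) + of_real (\<alpha> / \<beta>))"

definition form4 where
  "form4 D b (\<alpha>::real) (\<beta>::real) C1 lam C2 \<longleftrightarrow>
     \<beta> = 0 \<and> C1 \<noteq> 0 \<and> C2t C1 lam C2 = 0 \<and>
     (\<exists>C. \<forall>z\<in>D. z + lamt C1 lam \<noteq> 0 \<and>
        b z = of_real \<alpha> / (C1 * (z + lamt C1 lam)) + C)"

(* Linear a(z) = - lam z + C2: the quadratic coefficient C1 is 0 from here on. *)
definition form5 where
  "form5 D b (\<alpha>::real) (\<beta>::real) C1 lam C2 \<longleftrightarrow>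
     \<beta> \<noteq> 0 \<and> C1 = 0 \<and> lam \<noteq> 0 \<and>
     (\<exists>L C. log_branch D (\<lambda>z. - lam * z + C2) L \<and>
        (\<forall>z\<in>D. b z = C * exp (of_real \<beta> / (- lam) * L z) + of_real (\<alpha> / \<beta>)))"

definition form6 where
  "form6 D b (\<alpha>::real) (\<beta>::real) C1 lam C2 \<longleftrightarrow>
     \<beta> \<noteq> 0 \<and> C1 = 0 \<and> lam = 0 \<and> C2 \<noteq> 0 \<and>
     (\<exists>C. \<forall>z\<in>D. b z = C * exp (of_real \<beta> / C2 * z) + of_real (\<alpha> / \<beta>))"

definition form7 where
  "form7 D b (\<alpha>::real) (\<beta>::real) C1 lam C2 \<longleftrightarrow>
     \<beta> = 0 \<and> C1 = 0 \<and> lam = 0 \<and> C2 \<noteq> 0 \<and>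
     (\<exists>C. \<forall>z\<in>D. b z = - (of_real \<alpha> / C2) * z + C)"

definition form8 :: "complex set \<Rightarrow> (complex \<Rightarrow> complex) \<Rightarrow> bool" where
  "form8 D b \<longleftrightarrow> (\<exists>c. \<forall>z\<in>D. b z = c)"

definition listed_form :: "complex set \<Rightarrow> (complex \<Rightarrow> complex) \<Rightarrow> bool" where
  "listed_form D b \<longleftrightarrow>
     (\<exists>\<alpha> \<beta> C1 lam C2. admissible C1 lam C2 \<and>
        (form1 D b \<alpha> \<beta> C1 lam C2 \<or> form2 D b \<alpha> \<beta> C1 lam C2 \<or>
         form3 D b \<alpha> \<beta> C1 lam C2 \<or> form4 D b \<alpha> \<beta> C1 lam C2 \<or>
         form5 D b \<alpha> \<beta> C1 lam C2 \<or> form6 D b \<alpha> \<beta> C1 lam C2 \<or>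
         form7 D b \<alpha> \<beta> C1 lam C2)) \<or>
     form8 D b"

(* b(z) = (alpha / lam) ln z + C, the case beta = 0 of the generator of form5. It is invariant
   under alpha d_t - lam (z d_z - zbar d_zbar) but agrees with none of the eight forms. *)
definition log_form :: "complex set \<Rightarrow> (complex \<Rightarrow> complex) \<Rightarrow> bool" where
  "log_form D b \<longleftrightarrow>
     (\<exists>(\<alpha>::real) lam L C. \<alpha> \<noteq> 0 \<and> lam \<noteq> 0 \<and> cnj lam = - lam \<and> log_branch D (\<lambda>z. z) L \<and>
        (\<forall>z\<in>D. b z = of_real \<alpha> / lam * L z + C))"

end

theory Submission
  imports Defs
begin

text \<open>Off the singular set the solution is \<open>2 ln \<bar>t + b\<bar> - 2 ln (1 + \<bar>z\<bar>\<^sup>2)\<close>, so invariance under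
  \<open>(\<alpha>, \<beta>, a)\<close> reads \<open>2 Re (P / (t + b)) = Q\<close> with \<open>P = \<alpha> - \<beta> b + a b'\<close> and \<open>Q\<close> independent of \<open>t\<close>.
  Varying \<open>t\<close> gives \<open>Q = 0\<close>, and \<open>P = 0\<close> unless \<open>b\<close> is constant. The equation \<open>Q = 0\<close> says that \<open>a\<close>
  generates a rotation of the sphere; applying \<open>\<partial>\<^sub>z\<close> twice yields \<open>a''' = 0\<close>, so that \<open>a\<close> is an
  admissible quadratic polynomial. Integrating \<open>a b' = \<beta> b - \<alpha>\<close> then produces the listed forms. As \<open>D\<close>
  need not be simply connected, the logarithms have to be recovered from \<open>b\<close> itself.\<close>

subsection \<open>Wirtinger derivatives of the solution\<close>

text \<open>Every real-linear map of the plane is v -> A v + B cnj v for unique A and B, and for a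
  differential these are the two Wirtinger derivatives. Bundling them with differentiability lets
  one rule per operation deliver both values, whereas \<open>frechet_derivative\<close> is only a
  choice and cannot be computed with directly.\<close>

definition has_wirtinger :: "(complex \<Rightarrow> complex) \<Rightarrow> complex \<Rightarrow> complex \<Rightarrow> complex \<Rightarrow> bool" where
  "has_wirtinger f A B z \<longleftrightarrow> (f has_derivative (\<lambda>v. A * v + B * cnj v)) (at z)"

lemma has_wirtinger_unique:
  assumes "has_wirtinger f A B z" "has_wirtinger f A' B' z"
  shows "A = A'" "B = B'"
proof -
  have "(\<lambda>v. A * v + B * cnj v) = (\<lambda>v. A' * v + B' * cnj v)"
    using assms has_derivative_unique unfolding has_wirtinger_def by blast
  then have eq: "A * v + B * cnj v = A' * v + B' * cnj v" for v
    by meson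
  have "A + B = A' + B'"
    using eq [of 1] by simp
  moreover have "\<i> * (A - B) = \<i> * (A' - B')"
    using eq [of \<i>] by (simp add: algebra_simps)
  then have "A - B = A' - B'"
    by simp
  ultimately have "2 * A = 2 * A'" "2 * B = 2 * B'"
    by algebra+
  then show "A = A'" "B = B'"
    by auto
qed

lemma has_wirtinger_imp_wirtinger:
  assumes "has_wirtinger f A B z"
  shows "wirtinger f z = A" "wirtinger_bar f z = B"
proof -
  have "frechet_derivative f (at z) = (\<lambda>v. A * v + B * cnj v)"
    using assms frechet_derivative_at unfolding has_wirtinger_def by metis
  then show "wirtinger f z = A" "wirtinger_bar f z = B"
    by (simp_all add: wirtinger_def wirtinger_bar_def algebra_simps)
qed

lemma has_wirtinger_imp_differentiable: "has_wirtinger f A B z \<Longrightarrow> f differentiable (at z)"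
  unfolding has_wirtinger_def differentiable_def by blast

lemma has_wirtinger_transform:
  assumes "has_wirtinger f A B z" "open S" "z \<in> S" "\<And>w. w \<in> S \<Longrightarrow> f w = g w"
  shows "has_wirtinger g A B z"
  using assms has_derivative_transform_within_open unfolding has_wirtinger_def by blast

lemma has_wirtinger_const: "has_wirtinger (\<lambda>w. c) 0 0 z"
  unfolding has_wirtinger_def by simp

lemma has_wirtinger_ident: "has_wirtinger (\<lambda>w. w) 1 0 z"
  unfolding has_wirtinger_def by simp

lemma has_wirtinger_field:
  "(f has_field_derivative f') (at z) \<Longrightarrow> has_wirtinger f f' 0 z"
  unfolding has_wirtinger_def has_field_derivative_def by simp

lemma has_wirtinger_cnj:
  "has_wirtinger f A B z \<Longrightarrow> has_wirtinger (\<lambda>w. cnj (f w)) (cnj B) (cnj A) z"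
  unfolding has_wirtinger_def by (auto intro!: derivative_eq_intros simp: add.commute)

lemma has_wirtinger_add:
  "has_wirtinger f A B z \<Longrightarrow> has_wirtinger g A' B' z \<Longrightarrow>
    has_wirtinger (\<lambda>w. f w + g w) (A + A') (B + B') z"
  unfolding has_wirtinger_def by (auto intro!: derivative_eq_intros simp: algebra_simps)

lemma has_wirtinger_diff:
  "has_wirtinger f A B z \<Longrightarrow> has_wirtinger g A' B' z \<Longrightarrow>
    has_wirtinger (\<lambda>w. f w - g w) (A - A') (B - B') z"
  unfolding has_wirtinger_def by (auto intro!: derivative_eq_intros simp: algebra_simps)

lemma has_wirtinger_mult:
  "has_wirtinger f A B z \<Longrightarrow> has_wirtinger g A' B' z \<Longrightarrow>
    has_wirtinger (\<lambda>w. f w * g w) (A * g z + f z * A') (B * g z + f z * B') z"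
  unfolding has_wirtinger_def by (auto intro!: derivative_eq_intros simp: algebra_simps)

lemma has_wirtinger_divide:
  "has_wirtinger f A B z \<Longrightarrow> has_wirtinger g A' B' z \<Longrightarrow> g z \<noteq> 0 \<Longrightarrow>
    has_wirtinger (\<lambda>w. f w / g w) ((A * g z - f z * A') / (g z)\<^sup>2)
      ((B * g z - f z * B') / (g z)\<^sup>2) z"
  unfolding has_wirtinger_def
  by (auto intro!: derivative_eq_intros simp: divide_simps power2_eq_square)
     (auto simp: algebra_simps)

text \<open>d ln |f| = Re (df / f), and Re x = (x + cnj x) / 2 separates the complex-linear part
  from the antilinear one.\<close>

lemma has_wirtinger_ln_norm:
  assumes "has_wirtinger f A B z" "f z \<noteq> 0"
  shows "has_wirtinger (\<lambda>w. complex_of_real (ln (norm (f w))))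
    ((A / f z + cnj (B / f z)) / 2) ((B / f z + cnj (A / f z)) / 2) z"
proof -
  have inner: "inner x y / (cmod y)\<^sup>2 = Re (x / y)" if "y \<noteq> 0" for x y
    by (simp add: inner_complex_def Re_divide cmod_power2)
  have "((\<lambda>w. ln (norm (f w))) has_derivative (\<lambda>v. Re ((A * v + B * cnj v) / f z))) (at z)"
    using assms unfolding has_wirtinger_def
    by (auto intro!: derivative_eq_intros has_derivative_compose [OF _ has_derivative_norm]
        simp: inner [symmetric] sgn_div_norm power2_eq_square divide_simps)
  then have "((\<lambda>w. complex_of_real (ln (norm (f w)))) has_derivative
      (\<lambda>v. complex_of_real (Re ((A * v + B * cnj v) / f z)))) (at z)"
    by (rule has_derivative_of_real)
  moreover have "complex_of_real (Re ((A * v + B * cnj v) / f z)) =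
     (A / f z + cnj (B / f z)) / 2 * v + (B / f z + cnj (A / f z)) / 2 * cnj v" for v
  proof -
    have "2 * complex_of_real (Re x) = x + cnj x" for x
      by (simp add: complex_add_cnj)
    then have "complex_of_real (Re x) = (x + cnj x) / 2" for x
      by (simp add: field_simps)
    from this [of "(A * v + B * cnj v) / f z"] show ?thesis
      by (simp add: add_divide_distrib algebra_simps)
  qed
  ultimately show ?thesis
    unfolding has_wirtinger_def by simp
qed

lemma has_wirtinger_cmult:
  "has_wirtinger f A B z \<Longrightarrow> has_wirtinger (\<lambda>w. c * f w) (c * A) (c * B) z"
  using has_wirtinger_mult [OF has_wirtinger_const] by force

section \<open>The logarithmic form of the solution and its first derivatives\<close>

lemma one_plus_norm_square: "1 + z * cnj z = complex_of_real (1 + (norm z)\<^sup>2)"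
  using complex_norm_square [of z] by simp

lemma one_plus_norm_square_nonzero: "1 + z * cnj z \<noteq> 0" "1 + cnj z * z \<noteq> 0"
proof -
  have "1 + (norm z)\<^sup>2 \<noteq> 0"
    using zero_le_power2 [of "norm z"] by linarith
  then show "1 + z * cnj z \<noteq> 0"
    unfolding one_plus_norm_square of_real_eq_0_iff .
  then show "1 + cnj z * z \<noteq> 0"
    by (simp add: mult.commute)
qed

text \<open>The real part of \<open>Ln\<close> is the logarithm of the modulus, so conjugate
  arguments contribute equally and the branch cut leaves no trace. Later derivatives of
  \<open>sol\<close> are computed from this formula on open sets that avoid the singular
  points.\<close>

lemma sol_eq:
  assumes "of_real t + b z \<noteq> 0"
  shows "sol b z t = 2 * ln (norm (of_real t + b z)) - 2 * ln (norm (1 + z * cnj z))"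
proof -
  have "cnj (of_real t + b z) = of_real t + cnj (b z)" "z * cnj z + 1 = 1 + z * cnj z"
    by (simp_all add: add.commute)
  then show ?thesis
    using assms one_plus_norm_square_nonzero [of z] complex_mod_cnj [of "of_real t + b z"]
      complex_cnj_zero_iff [of "of_real t + b z"]
    unfolding sol_def by (simp del: complex_mod_cnj complex_cnj_zero_iff add: add.commute)
qed

text \<open>Each z loses at most one real t, so conditions on the projected domain become conditions
  on \<open>D\<close>.\<close>

lemma fst_sol_domain: "fst ` sol_domain D b = D"
proof -
  have "\<exists>t. complex_of_real t + b z \<noteq> 0" for z
    by (metis add_right_cancel of_real_eq_iff zero_neq_one)
  then show ?thesis
    unfolding sol_domain_def by force
qed

lemma open_translate_nonzero:
  assumes "open D" "b holomorphic_on D"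
  shows "open {z \<in> D. c + b z \<noteq> 0}"
proof -
  have "continuous_on D (\<lambda>z. c + b z)"
    using assms(2) holomorphic_on_imp_continuous_on by (intro continuous_intros)
  then have "open ((\<lambda>z. c + b z) -` (-{0}) \<inter> D)"
    using assms(1) continuous_on_open_vimage by blast
  moreover have "(\<lambda>z. c + b z) -` (-{0}) \<inter> D = {z \<in> D. c + b z \<noteq> 0}"
    by auto
  ultimately show ?thesis by simp
qed

lemma has_wirtinger_sol:
  assumes "open D" "b holomorphic_on D" "z \<in> D" "of_real t + b z \<noteq> 0"
  shows "has_wirtinger (\<lambda>w. complex_of_real (sol b w t))
    (deriv b z / (of_real t + b z) - 2 * cnj z / (1 + z * cnj z))
    (cnj (deriv b z) / (of_real t + cnj (b z)) - 2 * z / (1 + z * cnj z)) z"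
proof -
  have "(b has_field_derivative deriv b z) (at z)"
    using assms holomorphic_derivI by blast
  then have 1: "has_wirtinger (\<lambda>w. of_real t + b w) (deriv b z) 0 z"
    using has_wirtinger_add [OF has_wirtinger_const has_wirtinger_field] by fastforce
  have 2: "has_wirtinger (\<lambda>w. 1 + w * cnj w) (cnj z) z z"
    using has_wirtinger_add [OF has_wirtinger_const [of 1]
      has_wirtinger_mult [OF has_wirtinger_ident has_wirtinger_cnj [OF has_wirtinger_ident]]] by simp
  have half: "2 * (x / 2) = x" for x :: complex
    by simp
  from has_wirtinger_diff [OF
      has_wirtinger_cmult [where c=2, OF has_wirtinger_ln_norm [OF 1 assms(4)]]
      has_wirtinger_cmult [where c=2, OF has_wirtinger_ln_norm [OF 2 one_plus_norm_square_nonzero(1)]]]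
  have "has_wirtinger (\<lambda>w. 2 * complex_of_real (ln (norm (of_real t + b w)))
      - 2 * complex_of_real (ln (norm (1 + w * cnj w))))
    (deriv b z / (of_real t + b z) - 2 * cnj z / (1 + z * cnj z))
    (cnj (deriv b z) / (of_real t + cnj (b z)) - 2 * z / (1 + z * cnj z)) z"
    unfolding half by (simp add: mult.commute)
  then show ?thesis
    using has_wirtinger_transform [OF _ open_translate_nonzero [OF assms(1,2), of "of_real t"]] assms
    by (fastforce simp: sol_eq)
qed

lemma open_real_translate_nonzero: "open {s. complex_of_real s + c \<noteq> 0}"
  by (intro open_Collect_neq continuous_intros)

text \<open>The value is 2 Re (1 / (t + b)). As a number plus its conjugate it has the same shape as
  the two Wirtinger terms of the invariance condition.\<close>

lemma deriv_sol:
  assumes "of_real t + b z \<noteq> 0"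
  shows "complex_of_real (deriv (sol b z) t) = 1 / (of_real t + b z) + cnj (1 / (of_real t + b z))"
proof -
  have "((\<lambda>s. norm (complex_of_real s + b z)) has_derivative
      (\<lambda>v. inner (complex_of_real v) (sgn (of_real t + b z)))) (at t)"
    using assms by (auto intro!: derivative_eq_intros has_derivative_compose [OF _ has_derivative_norm])
  moreover have "(\<lambda>v. inner (complex_of_real v) (sgn (of_real t + b z))) = (*) (Re (sgn (of_real t + b z)))"
    by (auto simp: inner_complex_def)
  ultimately have "((\<lambda>s. norm (complex_of_real s + b z)) has_field_derivative
      Re (sgn (of_real t + b z))) (at t)"
    by (simp add: has_field_derivative_def)
  then have "((\<lambda>s. 2 * ln (norm (of_real s + b z)) - 2 * ln (norm (1 + z * cnj z)))
      has_field_derivative 2 * (Re (sgn (of_real t + b z)) / norm (of_real t + b z))) (at t)"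
    using assms by (auto intro!: derivative_eq_intros)
  then have "(sol b z has_field_derivative
      2 * (Re (sgn (of_real t + b z)) / norm (of_real t + b z))) (at t)"
    by (rule has_field_derivative_transform_within_open [OF _ open_real_translate_nonzero])
       (use assms sol_eq in auto)
  then have "deriv (sol b z) t = 2 * (Re (sgn (of_real t + b z)) / norm (of_real t + b z))"
    by (rule DERIV_imp_deriv)
  also have "\<dots> = 2 * Re (1 / (of_real t + b z))"
    using cmod_power2 [of "of_real t + b z"]
    by (simp add: sgn_div_norm Re_divide) (simp add: divide_simps power2_eq_square)
  finally show ?thesis
    by (metis complex_add_cnj)
qed

text \<open>Off the singular t, exp u equals |t + b|^2 / (1 + |z|^2)^2. This is quadratic in t with
  a leading coefficient free of b, so b will drop out of the second derivative.\<close>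

lemma has_derivative_exp_sol:
  assumes "of_real t + b z \<noteq> 0"
  shows "((\<lambda>s. exp (sol b z s)) has_field_derivative
     2 * (t + Re (b z)) / (norm (1 + z * cnj z))\<^sup>2) (at t)"
proof -
  define N where "N = (norm (1 + z * cnj z))\<^sup>2"
  have "N \<noteq> 0"
    using one_plus_norm_square_nonzero [of z] by (simp add: N_def)
  then have "((\<lambda>s. ((s + Re (b z))\<^sup>2 + (Im (b z))\<^sup>2) / N) has_field_derivative
     2 * (t + Re (b z)) / N) (at t)"
    by (auto intro!: derivative_eq_intros simp: field_simps)
  moreover have "((s + Re (b z))\<^sup>2 + (Im (b z))\<^sup>2) / N = exp (sol b z s)"
    if "complex_of_real s + b z \<noteq> 0" for s
  proof -
    have "exp (2 * ln x) = x\<^sup>2" if "x > 0" for x :: real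
      using that by (metis exp_ln ln_realpow of_nat_numeral zero_less_power)
    then show ?thesis
      using that one_plus_norm_square_nonzero [of z]
      by (simp add: sol_eq exp_diff cmod_power2 [of "_ + b z"] N_def)
  qed
  ultimately show ?thesis
    unfolding N_def using has_field_derivative_transform_within_open [OF _ open_real_translate_nonzero] assms by fastforce
qed

section \<open>Regularity and the heavenly equation\<close>

lemma open_sol_domain:
  assumes "open D" "b holomorphic_on D"
  shows "open (sol_domain D b)"
proof -
  have "continuous_on (D \<times> UNIV) (\<lambda>p::complex \<times> real. of_real (snd p) + b (fst p))"
    using assms(2) [THEN holomorphic_on_imp_continuous_on]
    by (intro continuous_intros continuous_on_compose2 [where f = fst and g = b]) auto
  then have "open ((\<lambda>p::complex \<times> real. of_real (snd p) + b (fst p)) -` (- {0}) \<inter> D \<times> UNIV)"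
    using assms(1) continuous_on_open_vimage [OF open_Times [OF _ open_UNIV]] by blast
  moreover have "(\<lambda>p::complex \<times> real. of_real (snd p) + b (fst p)) -` (- {0}) \<inter> D \<times> UNIV
      = sol_domain D b"
    by (auto simp: sol_domain_def)
  ultimately show ?thesis by simp
qed

lemma sol_differentiable:
  assumes "open D" "b holomorphic_on D" "z \<in> D" "of_real t + b z \<noteq> 0"
  shows "(\<lambda>(w, s). sol b w s) differentiable (at (z, t))"
proof -
  have "(b has_derivative (*) (deriv b z)) (at z)"
    using assms holomorphic_derivI unfolding has_field_derivative_def by blast
  then have b: "((\<lambda>p::complex \<times> real. b (fst p)) has_derivative (\<lambda>v. deriv b z * fst v)) (at (z, t))"
    using has_derivative_compose [OF has_derivative_fst [OF has_derivative_ident], of b "(*) (deriv b z)" "(z, t)" UNIV]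
    by simp
  have ln: "(\<lambda>p. ln (norm (f p))) differentiable (at (z, t))"
    if "f differentiable (at (z, t))" "f (z, t) \<noteq> 0" for f :: "complex \<times> real \<Rightarrow> complex"
  proof -
    from that obtain f' where f': "(f has_derivative f') (at (z, t))"
      unfolding differentiable_def by blast
    then show ?thesis
      unfolding differentiable_def using that(2)
      by (intro exI) (rule derivative_eq_intros has_derivative_compose [OF f' has_derivative_norm] refl | simp)+
  qed
  have "(\<lambda>p::complex \<times> real. of_real (snd p) + b (fst p)) differentiable (at (z, t))"
    unfolding differentiable_def using b by (intro exI) (rule derivative_eq_intros refl | assumption)+
  moreover have "(\<lambda>p::complex \<times> real. 1 + fst p * cnj (fst p)) differentiable (at (z, t))"
    unfolding differentiable_def by (intro exI) (rule derivative_eq_intros refl)+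
  ultimately have "(\<lambda>p. 2 * ln (norm (of_real (snd p) + b (fst p)))
      - 2 * ln (norm (1 + fst p * cnj (fst p)))) differentiable (at (z, t))"
    using assms(4) one_plus_norm_square_nonzero
    by (intro differentiable_diff differentiable_mult ln differentiable_const) auto
  then obtain f' where f': "((\<lambda>p. 2 * ln (norm (of_real (snd p) + b (fst p)))
      - 2 * ln (norm (1 + fst p * cnj (fst p)))) has_derivative f') (at (z, t))"
    unfolding differentiable_def by blast
  have "((\<lambda>(w, s). sol b w s) has_derivative f') (at (z, t))"
    by (rule has_derivative_transform_within_open [OF f' open_sol_domain [OF assms(1,2)]])
       (use assms(3,4) in \<open>auto simp: sol_domain_def sol_eq\<close>)
  then show ?thesis
    unfolding differentiable_def by blast
qed

text \<open>The b-part of the zbar-derivative of u is antiholomorphic and is killed by the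
  z-derivative. Only -2 ln (1 + |z|^2) contributes, giving -2 / (1 + |z|^2)^2, which is minus the
  second t-derivative of exp u.\<close>

lemma heavenly_solution_sol:
  assumes "open D" "b holomorphic_on D"
  shows "heavenly_solution (-1) (sol_domain D b) (sol b)"
  unfolding heavenly_solution_def
proof (intro ballI, clarify)
  fix z t
  assume "(z, t) \<in> sol_domain D b"
  then have z: "z \<in> D" and tz: "of_real t + b z \<noteq> 0"
    by (auto simp: sol_domain_def)
  have db: "(b has_field_derivative deriv b w) (at w)" if "w \<in> D" for w
    using assms that holomorphic_derivI by blast
  have db': "(deriv b has_field_derivative deriv (deriv b) w) (at w)" if "w \<in> D" for w
    using assms that holomorphic_derivI holomorphic_deriv by blast
  \<comment> \<open>The inner derivative must be known on a whole neighbourhood of z, at fixed t,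
    before it can be differentiated again.\<close>
  define S where "S = {w \<in> D. of_real t + b w \<noteq> 0}"
  have S: "open S" "z \<in> S"
    using open_translate_nonzero [OF assms] z tz by (auto simp: S_def)
  have bar: "cnj (deriv b w) / cnj (of_real t + b w) - 2 * w / (1 + w * cnj w) =
      wirtinger_bar (\<lambda>v. complex_of_real (sol b v t)) w" if "w \<in> S" for w
    using that has_wirtinger_imp_wirtinger(2) [OF has_wirtinger_sol [OF assms]] by (simp add: S_def)
  have "has_wirtinger (\<lambda>w. 1 + w * cnj w) (cnj z) z z"
    using has_wirtinger_add [OF has_wirtinger_const [of 1]
      has_wirtinger_mult [OF has_wirtinger_ident has_wirtinger_cnj [OF has_wirtinger_ident]]] by simp
  from has_wirtinger_divide [OF has_wirtinger_cmult [OF has_wirtinger_ident] this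
      one_plus_norm_square_nonzero(1), of 2]
  have "has_wirtinger (\<lambda>w. 2 * w / (1 + w * cnj w)) (2 / (1 + z * cnj z)\<^sup>2)
      (- 2 * z\<^sup>2 / (1 + z * cnj z)\<^sup>2) z"
    by (simp add: algebra_simps power2_eq_square)
  moreover obtain B where "has_wirtinger (\<lambda>w. cnj (deriv b w) / cnj (of_real t + b w)) 0 B z"
  proof -
    have "has_wirtinger (\<lambda>w. of_real t + b w) (deriv b z) 0 z"
      using has_wirtinger_add [OF has_wirtinger_const has_wirtinger_field [OF db [OF z]]] by simp
    from has_wirtinger_cnj [OF has_wirtinger_divide [OF has_wirtinger_field [OF db' [OF z]] this tz]]
    show ?thesis
      using that by simp
  qed
  ultimately obtain B where B: "has_wirtinger (\<lambda>w. cnj (deriv b w) / cnj (of_real t + b w) - 2 * w / (1 + w * cnj w))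
      (- 2 / (1 + z * cnj z)\<^sup>2) B z"
    using has_wirtinger_diff by fastforce
  have W: "has_wirtinger (wirtinger_bar (\<lambda>v. complex_of_real (sol b v t))) (- 2 / (1 + z * cnj z)\<^sup>2) B z"
    by (rule has_wirtinger_transform [OF B S bar])
  have "((\<lambda>s. 2 * (s + Re (b z)) / N) has_field_derivative 2 / N) (at t)" if "N \<noteq> 0" for N
    using that by (auto intro!: derivative_eq_intros simp: field_simps)
  then have "((\<lambda>s. 2 * (s + Re (b z)) / (norm (1 + z * cnj z))\<^sup>2) has_field_derivative
      2 / (norm (1 + z * cnj z))\<^sup>2) (at t)"
    using one_plus_norm_square_nonzero [of z] by simp
  then have dd: "(deriv (\<lambda>s. exp (sol b z s)) has_field_derivative 2 / (norm (1 + z * cnj z))\<^sup>2) (at t)"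
    by (rule has_field_derivative_transform_within_open [OF _ open_real_translate_nonzero])
       (use tz has_derivative_exp_sol [THEN DERIV_imp_deriv] in auto)
  have "(1 + z * cnj z)\<^sup>2 = complex_of_real ((norm (1 + z * cnj z))\<^sup>2)"
    unfolding one_plus_norm_square norm_of_real by simp
  then have "wirtinger (wirtinger_bar (\<lambda>v. complex_of_real (sol b v t))) z =
          of_real (- 1 * deriv (deriv (\<lambda>s. exp (sol b z s))) t)"
    unfolding has_wirtinger_imp_wirtinger(1) [OF W] DERIV_imp_deriv [OF dd]
    by simp
  moreover have "deriv (\<lambda>s. exp (sol b z s)) differentiable (at t)"
    using dd real_differentiable_def by blast
  ultimately show "(\<lambda>(w, s). sol b w s) differentiable (at (z, t)) \<and>
        wirtinger_bar (\<lambda>v. of_real (sol b v t)) differentiable (at z) \<and>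
        deriv (\<lambda>s. exp (sol b z s)) differentiable (at t) \<and>
        wirtinger (wirtinger_bar (\<lambda>v. of_real (sol b v t))) z =
          of_real (- 1 * deriv (deriv (\<lambda>s. exp (sol b z s))) t)"
    using sol_differentiable [OF assms z tz] has_wirtinger_imp_differentiable [OF W] by blast
qed

subsection \<open>The invariance condition\<close>

text \<open>The Killing equation of the round metric |dz|^2 / (1 + |z|^2)^2 for the real field a d_z
  + abar d_zbar. The denominator is cleared so that the equation can be differentiated by the
  product rule alone.\<close>

definition spherical_killing :: "(complex \<Rightarrow> complex) \<Rightarrow> complex \<Rightarrow> bool" where
  "spherical_killing a z \<longleftrightarrow>
     (1 + z * cnj z) * (deriv a z + cnj (deriv a z)) = 2 * (cnj z * a z + z * cnj (a z))"

text \<open>The generator maps t + b to \<beta> (t + b) plus this term, so its vanishing is the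
  characteristic equation a b' = \<beta> b - \<alpha>.\<close>

definition ode_residual ::
    "(complex \<Rightarrow> complex) \<Rightarrow> real \<Rightarrow> real \<Rightarrow> (complex \<Rightarrow> complex) \<Rightarrow> complex \<Rightarrow> complex" where
  "ode_residual b \<alpha> \<beta> a z = of_real \<alpha> - of_real \<beta> * b z + a z * deriv b z"

text \<open>Writing T = t + b, one has (\<alpha> + \<beta> t) / T = \<beta> + (\<alpha> - \<beta> b)
  / T. The terms 2 \<beta> cancel, all dependence on t is collected in residual / T on the left, and
  the right side is the defect in the Killing equation.\<close>

lemma invariant_under_sol_iff:
  assumes "open D" "b holomorphic_on D"
  shows "invariant_under (sol_domain D b) (sol b) \<alpha> \<beta> a \<longleftrightarrow>
    a holomorphic_on D \<and>
    (\<forall>z\<in>D. \<forall>t. complex_of_real t + b z \<noteq> 0 \<longrightarrow>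
      ode_residual b \<alpha> \<beta> a z / (of_real t + b z) + cnj (ode_residual b \<alpha> \<beta> a z / (of_real t + b z)) =
      2 * (cnj z * a z + z * cnj (a z)) / (1 + z * cnj z) - deriv a z - cnj (deriv a z))"
proof -
  have "of_real ((\<alpha> + \<beta> * t) * deriv (sol b z) t)
          + a z * wirtinger (\<lambda>w. of_real (sol b w t)) z
          + cnj (a z) * wirtinger_bar (\<lambda>w. of_real (sol b w t)) z
        = of_real (2 * \<beta>) - deriv a z - cnj (deriv a z) \<longleftrightarrow>
      ode_residual b \<alpha> \<beta> a z / (of_real t + b z) + cnj (ode_residual b \<alpha> \<beta> a z / (of_real t + b z)) =
      2 * (cnj z * a z + z * cnj (a z)) / (1 + z * cnj z) - deriv a z - cnj (deriv a z)"
    if z: "z \<in> D" and tz: "complex_of_real t + b z \<noteq> 0" for z t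
  proof -
    let ?T = "complex_of_real t + b z" and ?k = "of_real \<alpha> + of_real \<beta> * of_real t :: complex"
    have W: "wirtinger (\<lambda>w. of_real (sol b w t)) z = deriv b z / ?T - 2 * cnj z / (1 + z * cnj z)"
       "wirtinger_bar (\<lambda>w. of_real (sol b w t)) z =
          cnj (deriv b z / ?T) - 2 * z / (1 + z * cnj z)"
      using has_wirtinger_imp_wirtinger [OF has_wirtinger_sol [OF assms z tz]] by simp_all
    have k: "?k / ?T = of_real \<beta> + (of_real \<alpha> - of_real \<beta> * b z) / ?T"
      using tz by (simp add: field_simps)
    have "?k * (1 / ?T + cnj (1 / ?T)) = ?k / ?T + cnj (?k / ?T)"
      by (simp add: distrib_left)
    also have "\<dots> = 2 * of_real \<beta> + (of_real \<alpha> - of_real \<beta> * b z) / ?T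
       + cnj ((of_real \<alpha> - of_real \<beta> * b z) / ?T)"
      unfolding k by simp
    finally have "?k * (1 / ?T + cnj (1 / ?T)) + a z * (deriv b z / ?T) + cnj (a z) * cnj (deriv b z / ?T)
       = 2 * of_real \<beta> + ode_residual b \<alpha> \<beta> a z / ?T + cnj (ode_residual b \<alpha> \<beta> a z / ?T)"
      by (simp add: ode_residual_def add_divide_distrib)
    then have main: "?k * (1 / ?T + cnj (1 / ?T)) + a z * (deriv b z / ?T - 2 * cnj z / (1 + z * cnj z))
       + cnj (a z) * (cnj (deriv b z / ?T) - 2 * z / (1 + z * cnj z))
       = 2 * of_real \<beta> + ode_residual b \<alpha> \<beta> a z / ?T + cnj (ode_residual b \<alpha> \<beta> a z / ?T)
         - 2 * (cnj z * a z + z * cnj (a z)) / (1 + z * cnj z)"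
      by (simp add: right_diff_distrib distrib_left add_divide_distrib) (simp add: mult_ac add_ac)
    have "(X = B - d - e) = (p + q = N - d - e)" if "X = B + p + q - N"
      for X B N p q d e :: complex
      unfolding that by algebra
    note shift = this [OF main]
    have "complex_of_real (\<alpha> + \<beta> * t) = ?k" "complex_of_real (2 * \<beta>) = 2 * of_real \<beta>"
      by simp_all
    then show ?thesis
      unfolding W of_real_mult [of "\<alpha> + \<beta> * t"] deriv_sol [of t b z, OF tz]
      by (simp only: shift)
  qed
  then show ?thesis
    unfolding invariant_under_def fst_sol_domain by (auto simp: sol_domain_def)
qed

lemma invariant_under_solI:
  assumes "open D" "b holomorphic_on D" "a holomorphic_on D"
    and "\<And>z. z \<in> D \<Longrightarrow> ode_residual b \<alpha> \<beta> a z = 0"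
    and "\<And>z. z \<in> D \<Longrightarrow> spherical_killing a z"
  shows "invariant_under (sol_domain D b) (sol b) \<alpha> \<beta> a"
  using assms(3-5) one_plus_norm_square_nonzero
  unfolding invariant_under_sol_iff [OF assms(1,2)] spherical_killing_def
  by (auto simp: field_simps)

text \<open>With s = t + Re w, clearing the denominator gives a polynomial identity in s: s = 1 and
  s = -1 isolate Re p, and s = 2 then gives q = 0. Omitting s = 0 avoids the pole when w is real.
  The last alternative is genuine: an imaginary p over a real denominator has no real part.\<close>

lemma Re_divide_translates_constant:
  assumes "\<And>t. complex_of_real t + w \<noteq> 0 \<Longrightarrow> Re (p / (of_real t + w)) = q"
  shows "q = 0" "Re p = 0" "Im p = 0 \<or> Im w = 0"
proof -
  have eq: "Re p * s + Im p * Im w = q * (s\<^sup>2 + (Im w)\<^sup>2)" if "s \<noteq> 0" for s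
  proof -
    have "complex_of_real (s - Re w) + w = Complex s (Im w)"
      by (simp add: complex_eq_iff)
    moreover have "s\<^sup>2 + (Im w)\<^sup>2 \<noteq> 0"
      using that by (simp add: sum_power2_eq_zero_iff)
    ultimately show ?thesis
      using assms [of "s - Re w"] that
      by (auto simp: Re_divide complex_eq_iff divide_simps)
  qed
  from eq [of 1] eq [of "-1"] eq [of 2] show "q = 0" "Re p = 0"
    by (simp_all add: algebra_simps)
  with eq [of 1] show "Im p = 0 \<or> Im w = 0"
    by simp
qed

text \<open>Here z is fixed and only t varies. The possibility of a real \<open>b z\<close> cannot
  be excluded at a single point; it is removed later by holomorphy.\<close>

lemma invariant_under_sol_imp:
  assumes "open D" "b holomorphic_on D"
    and "invariant_under (sol_domain D b) (sol b) \<alpha> \<beta> a" "z \<in> D"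
  shows "spherical_killing a z" "Re (ode_residual b \<alpha> \<beta> a z) = 0"
    "Im (ode_residual b \<alpha> \<beta> a z) = 0 \<or> Im (b z) = 0"
proof -
  define Q where "Q = 2 * (cnj z * a z + z * cnj (a z)) / (1 + z * cnj z) - deriv a z - cnj (deriv a z)"
  let ?P = "ode_residual b \<alpha> \<beta> a z"
  have inv: "?P / (of_real t + b z) + cnj (?P / (of_real t + b z)) = Q"
    if "complex_of_real t + b z \<noteq> 0" for t
    using assms that unfolding invariant_under_sol_iff [OF assms(1,2)] Q_def by blast
  have inv': "complex_of_real (2 * Re (?P / (of_real t + b z))) = Q"
    if "complex_of_real t + b z \<noteq> 0" for t
    using inv [OF that] unfolding complex_add_cnj .
  have "Re (?P / (of_real t + b z)) = Re Q / 2" if "complex_of_real t + b z \<noteq> 0" for t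
    using arg_cong [OF inv' [OF that], of Re] by simp
  note Re = Re_divide_translates_constant [OF this]
  show "Re ?P = 0" "Im ?P = 0 \<or> Im (b z) = 0"
    using Re by auto
  \<comment> \<open>At a regular t, Q equals twice a real part, so Q is real and vanishes with its
    real part.\<close>
  obtain t where "complex_of_real t + b z \<noteq> 0"
    by (metis add_right_cancel of_real_eq_iff zero_neq_one)
  from inv' [OF this] have "Q = of_real (Re Q)"
    by (metis Re_complex_of_real)
  with Re(1) have "Q = 0"
    by simp
  then show "spherical_killing a z"
    using one_plus_norm_square_nonzero [of z]
    by (simp add: Q_def spherical_killing_def field_simps)
qed

subsection \<open>Killing fields of the sphere\<close>

lemma has_field_derivative_zero_imp_constant_on:
  fixes f :: "complex \<Rightarrow> complex"
  assumes "open D" "connected D" "\<And>z. z \<in> D \<Longrightarrow> (f has_field_derivative 0) (at z)"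
  shows "f constant_on D"
proof (rule DERIV_zero_connected_constant_on [OF assms(2,1) finite.emptyI])
  show "continuous_on D f"
    using assms(1,3) by (metis DERIV_isCont continuous_at_imp_continuous_on)
qed (use assms(3) in auto)

lemma deriv_zero_imp_constant:
  assumes "open D" "connected D" "f holomorphic_on D" "\<And>z. z \<in> D \<Longrightarrow> deriv f z = 0"
  shows "\<exists>c. \<forall>z\<in>D. f z = c"
  using has_field_derivative_zero_imp_constant_on [OF assms(1,2)] holomorphic_derivI [OF assms(3,1)] assms(4)
  unfolding constant_on_def by fastforce

text \<open>The device for differentiating an identity on \<open>D\<close>: written as f = 0, it
  yields one new identity for each Wirtinger derivative.\<close>

lemma wirtinger_zero_on_open:
  assumes "open D" "z \<in> D" "has_wirtinger f A B z" "\<And>w. w \<in> D \<Longrightarrow> f w = 0"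
  shows "A = 0" "B = 0"
  using has_wirtinger_unique [OF has_wirtinger_transform [OF assms(3,1,2) assms(4)] has_wirtinger_const]
  by auto

text \<open>The z-derivative of f + cnj f = 0 is f' = 0, since cnj f is antiholomorphic.\<close>

lemma Re_zero_imp_constant:
  assumes "open D" "connected D" "f holomorphic_on D" "\<And>z. z \<in> D \<Longrightarrow> Re (f z) = 0"
  shows "\<exists>c. \<forall>z\<in>D. f z = c"
proof (rule deriv_zero_imp_constant [OF assms(1-3)])
  fix z
  assume z: "z \<in> D"
  have W: "has_wirtinger f (deriv f z) 0 z"
    using z assms holomorphic_derivI has_wirtinger_field by blast
  have "f w + cnj (f w) = 0" if "w \<in> D" for w
    using assms(4) [OF that] by (simp add: complex_add_cnj)
  from wirtinger_zero_on_open(1) [OF assms(1) z has_wirtinger_add [OF W has_wirtinger_cnj [OF W]] this]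
  show "deriv f z = 0"
    by simp
qed

lemma deriv_quadratic: "deriv (\<lambda>z. C1 * z\<^sup>2 - lam * z + C2) z = 2 * C1 * z - lam"
  by (rule DERIV_imp_deriv) (auto intro!: derivative_eq_intros)

lemma admissible_spherical_killing:
  assumes "admissible C1 lam C2"
  shows "spherical_killing (\<lambda>z. C1 * z\<^sup>2 - lam * z + C2) z"
  using assms unfolding admissible_def spherical_killing_def deriv_quadratic
  by (auto simp: power2_eq_square algebra_simps)

text \<open>One z-derivative of the Killing equation gives \<open>G\<close>. The z-derivative of
  \<open>G\<close> is (1 + |z|^2) a''' = 0, and its zbar-derivative says Re (z a'' - a') = 0. So a'
  = c z + B with B imaginary, which is where the reality conditions come from.\<close>

lemma spherical_killing_imp_quadratic:
  assumes "open D" "connected D" "a holomorphic_on D" "\<And>z. z \<in> D \<Longrightarrow> spherical_killing a z"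
  obtains C1 lam C2 where "admissible C1 lam C2" "\<And>z. z \<in> D \<Longrightarrow> a z = C1 * z\<^sup>2 - lam * z + C2"
proof -
  have hol: "deriv a holomorphic_on D" "deriv (deriv a) holomorphic_on D"
    using assms holomorphic_deriv by blast+
  have W: "has_wirtinger a (deriv a z) 0 z" "has_wirtinger (deriv a) (deriv (deriv a) z) 0 z"
    "has_wirtinger (deriv (deriv a)) (deriv (deriv (deriv a)) z) 0 z" if "z \<in> D" for z
    using that assms hol holomorphic_derivI has_wirtinger_field by blast+
  note I = has_wirtinger_ident and C = has_wirtinger_cnj and A = has_wirtinger_add
    and M = has_wirtinger_mult and S = has_wirtinger_diff and K = has_wirtinger_const
  have G: "cnj z * (cnj (deriv a z) - deriv a z) + (1 + z * cnj z) * deriv (deriv a) z - 2 * cnj (a z) = 0"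
    if z: "z \<in> D" for z
  proof -
    have "(1 + w * cnj w) * (deriv a w + cnj (deriv a w)) - 2 * (cnj w * a w + w * cnj (a w)) = 0"
      if "w \<in> D" for w
      using assms(4) [OF that] unfolding spherical_killing_def by simp
    from wirtinger_zero_on_open(1) [OF assms(1) z _ this,
        OF S [OF M [OF A [OF K M [OF I C [OF I]]] A [OF W(2) C [OF W(2)]]]
           M [OF K A [OF M [OF C [OF I] W(1)] M [OF I C [OF W(1)]]]]]] z
    show ?thesis
      by (simp add: algebra_simps)
  qed
  have W': "has_wirtinger (\<lambda>z. cnj z * (cnj (deriv a z) - deriv a z) + (1 + z * cnj z) * deriv (deriv a) z - 2 * cnj (a z))
     ((1 + z * cnj z) * deriv (deriv (deriv a)) z)
     (z * deriv (deriv a) z + cnj z * cnj (deriv (deriv a) z) - deriv a z - cnj (deriv a z)) z"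
    if z: "z \<in> D" for z
    using S [OF A [OF M [OF C [OF I] S [OF C [OF W(2)] W(2)]] M [OF A [OF K M [OF I C [OF I]]] W(3)]]
       M [OF K C [OF W(1)]], OF z z z z, of 1 2]
    by (simp add: algebra_simps)
  have "deriv (deriv (deriv a)) z = 0" if "z \<in> D" for z
    using wirtinger_zero_on_open(1) [OF assms(1) that W' [OF that] G] one_plus_norm_square_nonzero [of z]
    by simp
  then obtain c where c: "\<And>z. z \<in> D \<Longrightarrow> deriv (deriv a) z = c"
    using deriv_zero_imp_constant [OF assms(1,2) hol(2)] by blast
  have Re0: "Re (deriv a z - c * z) = 0" if "z \<in> D" for z
  proof -
    have "(deriv a z - c * z) + cnj (deriv a z - c * z) = 0"
      using wirtinger_zero_on_open(2) [OF assms(1) that W' [OF that] G] that c by (simp add: algebra_simps)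
    then have "complex_of_real (2 * Re (deriv a z - c * z)) = 0"
      unfolding complex_add_cnj .
    then show ?thesis
      unfolding of_real_eq_0_iff by simp
  qed
  have "(\<lambda>z. deriv a z - c * z) holomorphic_on D"
    using hol assms(1,3) by (intro holomorphic_intros)
  from Re_zero_imp_constant [OF assms(1,2) this Re0]
  obtain B where B: "\<And>z. z \<in> D \<Longrightarrow> deriv a z - c * z = B"
    by blast
  show thesis
  proof (cases "D = {}")
    \<comment> \<open>Without a point of \<open>D\<close> nothing forces B to be imaginary, so the
      zero polynomial is supplied instead.\<close>
    case True
    then show ?thesis
      using that [of 0 0 0] by (simp add: admissible_def)
  next
    case False
    then have "Re B = 0"
      using B Re0 by fastforce
    then have cB: "cnj B = - B"
      by (simp add: complex_eq_iff)
    have "admissible (c / 2) (- B) (cnj c / 2)"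
      using cB by (simp add: admissible_def)
    moreover have "a z = c / 2 * z\<^sup>2 - (- B) * z + cnj c / 2" if "z \<in> D" for z
    proof -
      have d: "deriv a z = c * z + B"
        using B [OF that] by (simp add: algebra_simps)
      \<comment> \<open>No second integration is needed: with a'' = c, \<open>G\<close> can be
        solved for cnj a, which also fixes the constant term as cnj c / 2.\<close>
      have "cnj (a z) = (cnj z * (cnj (deriv a z) - deriv a z) + (1 + z * cnj z) * c) / 2"
        using G [OF that] c [OF that] by (simp add: field_simps)
      also have "\<dots> = cnj (c / 2 * z\<^sup>2 - (- B) * z + cnj c / 2)"
        using cB by (simp add: d field_simps power2_eq_square)
      finally show ?thesis
        using complex_cnj_cancel_iff by blast
    qed
    ultimately show ?thesis
      by (rule that)
  qed
qed

subsection \<open>Branches of the logarithm and the characteristic equation\<close>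

lemma log_branch_has_field_derivative:
  assumes "log_branch D g L" "open D" "z \<in> D" "(g has_field_derivative g') (at z)"
  shows "(L has_field_derivative g' / g z) (at z)"
proof -
  have L: "(L has_field_derivative deriv L z) (at z)"
    using assms holomorphic_derivI unfolding log_branch_def by blast
  then have "((\<lambda>w. exp (L w)) has_field_derivative exp (L z) * deriv L z) (at z)"
    by (auto intro!: derivative_eq_intros)
  then have "(g has_field_derivative exp (L z) * deriv L z) (at z)"
    by (rule has_field_derivative_transform_within_open [OF _ assms(2,3)])
       (use assms(1) in \<open>auto simp: log_branch_def\<close>)
  then have "g' = exp (L z) * deriv L z"
    using assms(4) DERIV_unique by blast
  moreover have "exp (L z) = g z"
    using assms by (auto simp: log_branch_def)
  moreover have "g z \<noteq> 0"
    using calculation(2) exp_not_eq_zero by metis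
  ultimately show ?thesis
    using L by simp
qed

text \<open>exp F / g has derivative zero, so it is a constant c, and subtracting Ln c from F
  removes it. The primitive is supplied rather than constructed, so \<open>D\<close> may have holes;
  for \<beta> = 0 a multiple of b serves as F.\<close>

lemma log_branch_of_primitive:
  assumes "open D" "connected D" "\<And>z. z \<in> D \<Longrightarrow> g z \<noteq> 0"
    and "\<And>z. z \<in> D \<Longrightarrow> (g has_field_derivative g' z) (at z)"
    and "\<And>z. z \<in> D \<Longrightarrow> (F has_field_derivative g' z / g z) (at z)"
  obtains k where "log_branch D g (\<lambda>z. F z - k)"
proof -
  have d: "((\<lambda>z. exp (F z) / g z) has_field_derivative 0) (at z)" if "z \<in> D" for z
    using assms(3-5) [OF that] by (auto intro!: derivative_eq_intros simp: field_simps)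
  have F: "F holomorphic_on D"
    using assms(1,5) holomorphic_on_open by blast
  have "(\<lambda>z. exp (F z) / g z) constant_on D"
    using has_field_derivative_zero_imp_constant_on [OF assms(1,2) d] .
  then obtain c where c: "\<And>z. z \<in> D \<Longrightarrow> exp (F z) = c * g z"
    using assms(3) unfolding constant_on_def by (metis nonzero_divide_eq_eq)
  show thesis
  proof
    have "exp (F z - Ln c) = g z" if "z \<in> D" for z
    proof -
      have "c \<noteq> 0"
        using c [OF that] by auto
      then show ?thesis
        using c [OF that] by (simp add: exp_diff)
    qed
    then show "log_branch D g (\<lambda>z. F z - Ln c)"
      using F unfolding log_branch_def by (auto intro!: holomorphic_intros)
  qed
qed

text \<open>Since \<open>\<gamma>\<close> is purely imaginary, \<open>\<bar>h\<bar>\<close> determines the argument of \<open>g\<close>, so \<open>ln \<bar>g\<bar> - (\<i> / Im \<gamma>) ln \<bar>h\<bar>\<close> is a single-valued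
  primitive of \<open>g' / g\<close> even if \<open>D\<close> is not simply connected.\<close>

lemma log_branch_of_imaginary_power:
  assumes "open D" "connected D" "Re \<gamma> = 0" "\<gamma> \<noteq> 0"
    and "\<And>z. z \<in> D \<Longrightarrow> g z \<noteq> 0" "\<And>z. z \<in> D \<Longrightarrow> h z \<noteq> 0"
    and g': "\<And>z. z \<in> D \<Longrightarrow> (g has_field_derivative g' z) (at z)"
    and h': "\<And>z. z \<in> D \<Longrightarrow> (h has_field_derivative \<gamma> * (g' z / g z) * h z) (at z)"
  obtains L C where "log_branch D g L" "\<And>z. z \<in> D \<Longrightarrow> h z = C * exp (\<gamma> * L z)"
proof -
  define y where "y = Im \<gamma>"
  define F where "F z = complex_of_real (ln (norm (g z))) - \<i> / y * complex_of_real (ln (norm (h z)))" for z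
  have \<gamma>: "\<gamma> = \<i> * y" "y \<noteq> 0"
    using assms(3,4) by (auto simp: complex_eq_iff y_def)
  have F': "(F has_field_derivative g' z / g z) (at z)" if z: "z \<in> D" for z
  proof -
    \<comment> \<open>With q = g' / g and h' / h = \<gamma> q, these are the two Wirtinger
      coefficients of \<open>F\<close>. The antilinear one cancels because \<gamma> = i y with y
      real, so \<open>F\<close> is holomorphic.\<close>
    have half: "q / 2 - \<i> / y * (\<gamma> * q / 2) = q" "cnj q / 2 - \<i> / y * (cnj (\<gamma> * q) / 2) = 0" for q
      unfolding \<gamma>(1) using \<gamma>(2) by (simp_all add: field_simps)
    have "has_wirtinger F
        (g' z / g z / 2 - \<i> / y * (\<gamma> * (g' z / g z) / 2))
        (cnj (g' z / g z) / 2 - \<i> / y * (cnj (\<gamma> * (g' z / g z)) / 2)) z"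
      using has_wirtinger_diff [OF has_wirtinger_ln_norm [OF has_wirtinger_field [OF g' [OF z]]]
         has_wirtinger_cmult [where c = "\<i> / y", OF has_wirtinger_ln_norm [OF has_wirtinger_field [OF h' [OF z]]]]]
        assms(5,6) [OF z]
      unfolding F_def by simp
    then show ?thesis
      unfolding half has_wirtinger_def has_field_derivative_def
      by (simp only: mult_zero_left add_0_right)
  qed
  obtain k where L: "log_branch D g (\<lambda>z. F z - k)"
    using log_branch_of_primitive [OF assms(1,2) assms(5) g' F'] by blast
  have "((\<lambda>z. h z / exp (\<gamma> * (F z - k))) has_field_derivative 0) (at z)" if "z \<in> D" for z
    using F' [OF that] h' [OF that] by (auto intro!: derivative_eq_intros simp: field_simps)
  from has_field_derivative_zero_imp_constant_on [OF assms(1,2) this] obtain C where "\<And>z. z \<in> D \<Longrightarrow> h z = C * exp (\<gamma> * (F z - k))"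
    unfolding constant_on_def by (metis exp_not_eq_zero nonzero_divide_eq_eq)
  with L that show thesis
    by blast
qed

text \<open>At a common zero of \<open>h\<close> and \<open>a\<close>, with \<open>h\<close> of order \<open>n\<close>, comparing leading coefficients
  gives \<open>n a' = \<beta>\<close>, whereas the Killing equation forces \<open>Re a' = 0\<close> at zeros of \<open>a\<close>.\<close>

lemma euler_ode_solution_nonzero:
  fixes \<beta> :: real and h a :: "complex \<Rightarrow> complex"
  assumes "open D" "connected D" "h holomorphic_on D" "a holomorphic_on D"
    and ode: "\<And>z. z \<in> D \<Longrightarrow> a z * deriv h z = \<beta> * h z" and "\<beta> \<noteq> 0"
    and kill: "\<And>z. z \<in> D \<Longrightarrow> spherical_killing a z"
    and "\<not> h constant_on D" "z \<in> D"
  shows "h z \<noteq> 0"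
proof
  assume "h z = 0"
  then obtain g r n where n: "0 < n" and r: "0 < r" "ball z r \<subseteq> D" and g: "g holomorphic_on ball z r"
    and hg: "\<And>w. w \<in> ball z r \<Longrightarrow> h w = (w - z) ^ n * g w"
    and g0: "\<And>w. w \<in> ball z r \<Longrightarrow> g w \<noteq> 0"
    using holomorphic_factor_zero_nonconstant [OF assms(3,1,2,9) _ assms(8)] by metis
  then obtain m where m: "n = Suc m"
    using gr0_implies_Suc by blast
  have zb: "z \<in> ball z r"
    using r by simp
  have g': "(g has_field_derivative deriv g w) (at w)" if "w \<in> ball z r" for w
    using that g holomorphic_derivI by blast
  \<comment> \<open>\<open>K\<close> is what remains of a h' - \<beta> h after h = (w - z)^n g is
    inserted and the power n - 1 is factored out. It vanishes off z by the equation and at z by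
    continuity; the value at z gives a(z) = 0.\<close>
  define K where "K w = a w * (of_nat n * g w + (w - z) * deriv g w) - \<beta> * ((w - z) * g w)" for w
  have K0: "K w = 0" if w: "w \<in> ball z r" "w \<noteq> z" for w
  proof -
    have "((\<lambda>w. (w - z) ^ n * g w) has_field_derivative
        (w - z) ^ m * (of_nat n * g w + (w - z) * deriv g w)) (at w)"
      unfolding m by (rule derivative_eq_intros g' w refl)+ (simp add: algebra_simps)
    then have "(h has_field_derivative (w - z) ^ m * (of_nat n * g w + (w - z) * deriv g w)) (at w)"
      by (rule has_field_derivative_transform_within_open [OF _ open_ball w(1)]) (simp add: hg)
    from ode [of w] DERIV_imp_deriv [OF this] have "(w - z) ^ m * K w = 0"
      using w r by (simp add: subset_iff K_def hg m algebra_simps)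
    then show ?thesis
      using w by simp
  qed
  have a: "a holomorphic_on ball z r"
    using assms(4) r holomorphic_on_subset by blast
  have Khol: "K holomorphic_on ball z r"
    unfolding K_def by (intro holomorphic_intros a g holomorphic_deriv open_ball)
  have "K \<midarrow>z\<rightarrow> K z"
    using field_differentiable_imp_continuous_at [OF holomorphic_on_imp_differentiable_at [OF Khol open_ball zb]]
    by (simp add: isCont_def)
  moreover have "K \<midarrow>z\<rightarrow> 0"
    by (rule tendsto_eventually, rule eventually_mono [OF eventually_at_ball' [OF r(1), of z UNIV]])
       (use K0 in auto)
  ultimately have "K z = 0"
    using LIM_unique by blast
  then have az: "a z = 0"
    using g0 [OF zb] n by (simp add: K_def)
  have a': "(a has_field_derivative deriv a z) (at z)"
    using a zb holomorphic_derivI by blast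
  have "(deriv g has_field_derivative deriv (deriv g) z) (at z)"
    using g zb holomorphic_derivI holomorphic_deriv by blast
  \<comment> \<open>Since a(z) = 0, the next order of \<open>K\<close> at z is n a'(z) - \<beta>
    times g(z).\<close>
  then have "(K has_field_derivative (deriv a z * of_nat n - \<beta>) * g z) (at z)"
    unfolding K_def using az
    by (auto intro!: derivative_eq_intros a' g' zb simp: algebra_simps)
  moreover have "(K has_field_derivative 0) (at z)"
    by (rule has_field_derivative_transform_within_open [OF DERIV_const open_ball zb, of 0])
       (use K0 \<open>K z = 0\<close> in metis)
  ultimately have "(deriv a z * of_nat n - \<beta>) * g z = 0"
    using DERIV_unique by blast
  then have "deriv a z * of_nat n = \<beta>"
    using g0 [OF zb] by simp
  then have "Re (deriv a z * of_nat n) = \<beta>"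
    by simp
  then have "Re (deriv a z) * n = \<beta>"
    by simp
  moreover have "Re (deriv a z) = 0"
    using kill [OF assms(9)] one_plus_norm_square_nonzero [of z]
    by (simp add: spherical_killing_def az complex_add_cnj)
  ultimately show False
    using assms(6) by simp
qed

subsection \<open>The listed forms\<close>

text \<open>lam is imaginary and C1 C2 = |C1|^2, so the product is |C1|^2 + (Im lam)^2 / 4. Hence
  the quadratic has two distinct zeros, the fixed points of the rotation.\<close>

lemma admissible_C2t:
  assumes "admissible C1 lam C2" "C1 \<noteq> 0"
  shows "\<exists>r>0. C1 * C2t C1 lam C2 = complex_of_real r"
proof (intro exI conjI)
  show "(norm C1)\<^sup>2 + (Im lam)\<^sup>2 / 4 > 0"
    using assms(2) by (intro add_pos_nonneg) auto
  have "Re lam = 0"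
    using assms(1) by (simp add: admissible_def complex_eq_iff)
  then have "lam\<^sup>2 = - complex_of_real ((Im lam)\<^sup>2)"
    by (simp add: complex_eq_iff power2_eq_square)
  moreover have "C1 * C2 = complex_of_real ((norm C1)\<^sup>2)"
    using assms(1) complex_norm_square [of C1] by (simp add: admissible_def)
  ultimately show "C1 * C2t C1 lam C2 = complex_of_real ((norm C1)\<^sup>2 + (Im lam)\<^sup>2 / 4)"
    using assms(2) by (simp add: C2t_def field_simps)
qed

lemma C2t_nonzero: "admissible C1 lam C2 \<Longrightarrow> C1 \<noteq> 0 \<Longrightarrow> C2t C1 lam C2 \<noteq> 0"
  using admissible_C2t by fastforce

text \<open>\<sigma>^2 is a negative real. This makes the exponent \<beta> / (2 \<sigma>) purely
  imaginary, as \<open>log_branch_of_imaginary_power\<close> requires.\<close>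

lemma roots_imaginary:
  assumes "admissible C1 lam C2" "C1 \<noteq> 0" "roots C1 (C2t C1 lam C2) \<nu> \<sigma>"
  shows "Re \<sigma> = 0" "\<sigma> \<noteq> 0"
proof -
  obtain r where "r > 0" "\<sigma>\<^sup>2 = - complex_of_real r"
    using admissible_C2t [OF assms(1,2)] assms(3) by (auto simp: roots_def)
  then have "(Re \<sigma>)\<^sup>2 - (Im \<sigma>)\<^sup>2 < 0" "Re \<sigma> * Im \<sigma> = 0"
    by (auto simp: complex_eq_iff power2_eq_square)
  then show "Re \<sigma> = 0" "\<sigma> \<noteq> 0"
    by (cases "Im \<sigma> = 0"; force)+
qed

lemma roots_exist: "C1 \<noteq> 0 \<Longrightarrow> roots C1 c (csqrt (- c / C1)) (C1 * csqrt (- c / C1))"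
  by (simp add: roots_def power_mult_distrib power2_eq_square [of C1])

lemma complete_square:
  assumes "C1 \<noteq> 0"
  shows "C1 * (z + lamt C1 lam)\<^sup>2 + C2t C1 lam C2 = C1 * z\<^sup>2 - lam * z + C2"
  using assms by (simp add: lamt_def C2t_def field_simps power2_eq_square)

lemma roots_factor:
  assumes "C1 \<noteq> 0" "roots C1 (C2t C1 lam C2) \<nu> \<sigma>"
  shows "C1 * z\<^sup>2 - lam * z + C2 = C1 * ((z + lamt C1 lam - \<nu>) * (z + lamt C1 lam + \<nu>))"
proof -
  have "C2t C1 lam C2 = - (C1 * \<nu>\<^sup>2)"
    using assms by (simp add: roots_def field_simps)
  then show ?thesis
    unfolding complete_square [OF assms(1), symmetric] by (simp add: power2_eq_square algebra_simps)
qed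

text \<open>The two linear factors differ by 2 \<nu> and a is C1 times their product, so the
  quotient has logarithmic derivative 2 \<sigma> / a. Its reciprocal has the opposite sign, which
  suits b' = - \<alpha> / a in form 2.\<close>

lemma has_field_derivative_root_quotient:
  assumes "C1 \<noteq> 0" "roots C1 (C2t C1 lam C2) \<nu> \<sigma>"
    and "z + lamt C1 lam - \<nu> \<noteq> 0" "z + lamt C1 lam + \<nu> \<noteq> 0"
  shows "((\<lambda>z. (z + lamt C1 lam - \<nu>) / (z + lamt C1 lam + \<nu>)) has_field_derivative
      2 * \<sigma> / (C1 * z\<^sup>2 - lam * z + C2) * ((z + lamt C1 lam - \<nu>) / (z + lamt C1 lam + \<nu>))) (at z)"
    and "((\<lambda>z. (z + lamt C1 lam + \<nu>) / (z + lamt C1 lam - \<nu>)) has_field_derivative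
      - 2 * \<sigma> / (C1 * z\<^sup>2 - lam * z + C2) * ((z + lamt C1 lam + \<nu>) / (z + lamt C1 lam - \<nu>))) (at z)"
proof -
  define X Y where "X = z + lamt C1 lam - \<nu>" and "Y = z + lamt C1 lam + \<nu>"
  have nz: "C1 \<noteq> 0" "X \<noteq> 0" "Y \<noteq> 0"
    using assms by (simp_all add: X_def Y_def)
  have \<nu>: "Y - X = 2 * \<nu>" and \<sigma>: "\<sigma> = C1 * \<nu>"
    using assms by (simp_all add: X_def Y_def roots_def)
  have "((\<lambda>z. (z + lamt C1 lam - \<nu>) / (z + lamt C1 lam + \<nu>)) has_field_derivative
      (Y - X) / (Y * Y)) (at z)"
    by (rule derivative_eq_intros refl assms(4))+ (simp add: X_def Y_def)
  moreover have "(Y - X) / (Y * Y) = 2 * \<sigma> / (C1 * (X * Y)) * (X / Y)"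
    using nz by (simp add: \<nu> \<sigma>)
  ultimately show "((\<lambda>z. (z + lamt C1 lam - \<nu>) / (z + lamt C1 lam + \<nu>)) has_field_derivative
      2 * \<sigma> / (C1 * z\<^sup>2 - lam * z + C2) * ((z + lamt C1 lam - \<nu>) / (z + lamt C1 lam + \<nu>))) (at z)"
    unfolding roots_factor [OF assms(1,2)] X_def Y_def by simp
  have "((\<lambda>z. (z + lamt C1 lam + \<nu>) / (z + lamt C1 lam - \<nu>)) has_field_derivative
      - (Y - X) / (X * X)) (at z)"
    by (rule derivative_eq_intros refl assms(3))+ (simp add: X_def Y_def)
  moreover have "- (Y - X) / (X * X) = - 2 * \<sigma> / (C1 * (X * Y)) * (Y / X)"
    using nz unfolding \<nu> \<sigma> by simp
  ultimately show "((\<lambda>z. (z + lamt C1 lam + \<nu>) / (z + lamt C1 lam - \<nu>)) has_field_derivative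
      - 2 * \<sigma> / (C1 * z\<^sup>2 - lam * z + C2) * ((z + lamt C1 lam + \<nu>) / (z + lamt C1 lam - \<nu>))) (at z)"
    unfolding roots_factor [OF assms(1,2)] X_def Y_def by simp
qed

section \<open>The listed forms solve the characteristic equation\<close>

lemma ode_residual_eqI:
  assumes "open D" "z \<in> D" "\<And>w. w \<in> D \<Longrightarrow> b w = f w" "(f has_field_derivative f') (at z)"
    and "of_real \<alpha> - of_real \<beta> * f z + a z * f' = 0"
  shows "ode_residual b \<alpha> \<beta> a z = 0"
proof -
  have "(b has_field_derivative f') (at z)"
    by (rule has_field_derivative_transform_within_open [OF assms(4,1,2)]) (simp add: assms(3))
  then show ?thesis
    using assms DERIV_imp_deriv unfolding ode_residual_def by metis
qed

lemma form1_imp_ode: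
  assumes "open D" "form1 D b \<alpha> \<beta> C1 lam C2" "z \<in> D"
  shows "ode_residual b \<alpha> \<beta> (\<lambda>z. C1 * z\<^sup>2 - lam * z + C2) z = 0"
proof -
  obtain \<nu> \<sigma> L C where c: "\<beta> \<noteq> 0" "C1 \<noteq> 0" "C2t C1 lam C2 \<noteq> 0" and r: "roots C1 (C2t C1 lam C2) \<nu> \<sigma>"
    and L: "log_branch D (\<lambda>z. (z + lamt C1 lam - \<nu>) / (z + lamt C1 lam + \<nu>)) L"
    and b: "\<And>z. z \<in> D \<Longrightarrow> b z = C * exp (of_real \<beta> / (2 * \<sigma>) * L z) + of_real (\<alpha> / \<beta>)"
    using assms(2) unfolding form1_def by blast
  have "(z + lamt C1 lam - \<nu>) / (z + lamt C1 lam + \<nu>) \<noteq> 0"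
    using L assms(3) exp_not_eq_zero unfolding log_branch_def by metis
  then have nz: "z + lamt C1 lam - \<nu> \<noteq> 0" "z + lamt C1 lam + \<nu> \<noteq> 0"
    by auto
  have q: "C1 * z\<^sup>2 - lam * z + C2 \<noteq> 0"
    using nz c(2) roots_factor [OF c(2) r, of z] by simp
  have \<sigma>: "\<sigma> \<noteq> 0"
    using r c by (auto simp: roots_def)
  have L': "(L has_field_derivative 2 * \<sigma> / (C1 * z\<^sup>2 - lam * z + C2)) (at z)"
    using log_branch_has_field_derivative [OF L assms(1,3) has_field_derivative_root_quotient(1) [OF c(2) r nz]] nz
    by simp
  show ?thesis
  proof (rule ode_residual_eqI [OF assms(1,3) b])
    show "((\<lambda>z. C * exp (of_real \<beta> / (2 * \<sigma>) * L z) + of_real (\<alpha> / \<beta>)) has_field_derivative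
       C * exp (of_real \<beta> / (2 * \<sigma>) * L z) * (of_real \<beta> / (C1 * z\<^sup>2 - lam * z + C2))) (at z)"
      by (rule derivative_eq_intros L' refl)+ (use \<sigma> in simp)
  qed (use q c in \<open>simp_all add: field_simps\<close>)
qed

text \<open>The second claim serves nontriviality of the generator: here \<beta> = 0 and \<alpha>
  may vanish too, so a itself must be nonzero.\<close>

lemma form2_imp_ode:
  assumes "open D" "form2 D b \<alpha> \<beta> C1 lam C2" "z \<in> D"
  shows "ode_residual b \<alpha> \<beta> (\<lambda>z. C1 * z\<^sup>2 - lam * z + C2) z = 0"
    and "C1 * z\<^sup>2 - lam * z + C2 \<noteq> 0"
proof -
  obtain \<nu> \<sigma> L C where c: "\<beta> = 0" "C1 \<noteq> 0" "C2t C1 lam C2 \<noteq> 0" and r: "roots C1 (C2t C1 lam C2) \<nu> \<sigma>"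
    and L: "log_branch D (\<lambda>z. (z + lamt C1 lam + \<nu>) / (z + lamt C1 lam - \<nu>)) L"
    and b: "\<And>z. z \<in> D \<Longrightarrow> b z = of_real \<alpha> / (2 * \<sigma>) * L z + C"
    using assms(2) unfolding form2_def by blast
  have "(z + lamt C1 lam + \<nu>) / (z + lamt C1 lam - \<nu>) \<noteq> 0"
    using L assms(3) exp_not_eq_zero unfolding log_branch_def by metis
  then have nz: "z + lamt C1 lam - \<nu> \<noteq> 0" "z + lamt C1 lam + \<nu> \<noteq> 0"
    by auto
  show q: "C1 * z\<^sup>2 - lam * z + C2 \<noteq> 0"
    using nz c(2) roots_factor [OF c(2) r, of z] by simp
  have \<sigma>: "\<sigma> \<noteq> 0"
    using r c by (auto simp: roots_def)
  have L': "(L has_field_derivative - 2 * \<sigma> / (C1 * z\<^sup>2 - lam * z + C2)) (at z)"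
    using log_branch_has_field_derivative [OF L assms(1,3) has_field_derivative_root_quotient(2) [OF c(2) r nz]] nz
    by simp
  show "ode_residual b \<alpha> \<beta> (\<lambda>z. C1 * z\<^sup>2 - lam * z + C2) z = 0"
  proof (rule ode_residual_eqI [OF assms(1,3) b])
    show "((\<lambda>z. of_real \<alpha> / (2 * \<sigma>) * L z + C) has_field_derivative
       - of_real \<alpha> / (C1 * z\<^sup>2 - lam * z + C2)) (at z)"
      by (rule derivative_eq_intros L' refl)+ (use \<sigma> in simp)
  qed (use q c in \<open>simp_all add: field_simps\<close>)
qed

lemma form5_imp_ode:
  assumes "open D" "admissible C1 lam C2" "form5 D b \<alpha> \<beta> C1 lam C2" "z \<in> D"
  shows "ode_residual b \<alpha> \<beta> (\<lambda>z. C1 * z\<^sup>2 - lam * z + C2) z = 0"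
proof -
  have c: "\<beta> \<noteq> 0" "C1 = 0" "lam \<noteq> 0" "C2 = 0"
    using assms(2,3) by (auto simp: form5_def admissible_def)
  then obtain L C where L: "log_branch D (\<lambda>z. - lam * z) L"
    and b: "\<And>z. z \<in> D \<Longrightarrow> b z = C * exp (of_real \<beta> / (- lam) * L z) + of_real (\<alpha> / \<beta>)"
    using assms(3) unfolding form5_def by auto
  have z: "- lam * z \<noteq> 0"
    using L assms(4) exp_not_eq_zero unfolding log_branch_def by metis
  have L': "(L has_field_derivative (- lam) / (- lam * z)) (at z)"
    by (rule log_branch_has_field_derivative [OF L assms(1,4)]) (auto intro!: derivative_eq_intros)
  show ?thesis
  proof (rule ode_residual_eqI [OF assms(1,4) b])
    show "((\<lambda>z. C * exp (of_real \<beta> / (- lam) * L z) + of_real (\<alpha> / \<beta>)) has_field_derivative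
       C * exp (of_real \<beta> / (- lam) * L z) * (of_real \<beta> / (- lam * z))) (at z)"
      by (rule derivative_eq_intros L' refl)+ (use z in \<open>simp add: mult_ac\<close>)
  qed (use z c in \<open>simp_all add: field_simps\<close>)
qed

lemma form8_imp_ode:
  assumes "open D" "form8 D b" "z \<in> D"
  shows "ode_residual b 0 0 a z = 0"
proof -
  obtain c where "\<And>z. z \<in> D \<Longrightarrow> b z = c"
    using assms(2) by (auto simp: form8_def)
  then show ?thesis
    by (intro ode_residual_eqI [OF assms(1,3), of b "\<lambda>z. c" 0]) auto
qed

lemma invariant_under_quadraticI:
  assumes "open D" "b holomorphic_on D" "admissible C1 lam C2"
    and "\<And>z. z \<in> D \<Longrightarrow> ode_residual b \<alpha> \<beta> (\<lambda>z. C1 * z\<^sup>2 - lam * z + C2) z = 0"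
  shows "invariant_under (sol_domain D b) (sol b) \<alpha> \<beta> (\<lambda>z. C1 * z\<^sup>2 - lam * z + C2)"
  by (rule invariant_under_solI [OF assms(1,2) _ assms(4)])
     (auto intro!: holomorphic_intros admissible_spherical_killing assms(3))

lemma forms_3_4_6_7_impossible:
  assumes "admissible C1 lam C2"
  shows "\<not> form3 D b \<alpha> \<beta> C1 lam C2" "\<not> form4 D b \<alpha> \<beta> C1 lam C2"
    "\<not> form6 D b \<alpha> \<beta> C1 lam C2" "\<not> form7 D b \<alpha> \<beta> C1 lam C2"
  using C2t_nonzero [OF assms] assms
  by (auto simp: form3_def form4_def form6_def form7_def admissible_def)

lemma listed_form_imp_not_noninvariant:
  assumes "open D" "D \<noteq> {}" "b holomorphic_on D" "listed_form D b"
  shows "\<not> noninvariant_solution \<kappa> (sol_domain D b) (sol b)"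
proof -
  obtain z0 where z0: "z0 \<in> D"
    using assms(2) by blast
  have "\<exists>\<alpha> \<beta> a. \<not> (\<alpha> = 0 \<and> \<beta> = 0 \<and> (\<forall>z\<in>D. a z = 0)) \<and>
      invariant_under (sol_domain D b) (sol b) \<alpha> \<beta> a"
  proof (cases "form8 D b")
    case True
    \<comment> \<open>Any rotation leaves a constant b invariant. The choices a = z^2 + 1 and a = -
      i z are made so that a does not vanish at \<open>z0\<close>.\<close>
    define p where "p = (if z0 = 0 then (1 :: complex, 0 :: complex, 1 :: complex) else (0, \<i>, 0))"
    obtain C1 lam C2 where p: "p = (C1, lam, C2)"
      by (cases p)
    have ad: "admissible C1 lam C2" and nz: "C1 * z0\<^sup>2 - lam * z0 + C2 \<noteq> 0"
      using p by (auto simp: p_def admissible_def split: if_splits)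
    then show ?thesis
      using invariant_under_quadraticI [OF assms(1,3) ad form8_imp_ode [OF assms(1) True]] nz z0
      by (intro exI [of _ 0] exI [of _ "\<lambda>z. C1 * z\<^sup>2 - lam * z + C2"]) auto
  next
    case False
    then obtain \<alpha> \<beta> C1 lam C2 where ad: "admissible C1 lam C2"
      and f: "form1 D b \<alpha> \<beta> C1 lam C2 \<or> form2 D b \<alpha> \<beta> C1 lam C2 \<or> form5 D b \<alpha> \<beta> C1 lam C2"
      using assms(4) forms_3_4_6_7_impossible unfolding listed_form_def by metis
    have "invariant_under (sol_domain D b) (sol b) \<alpha> \<beta> (\<lambda>z. C1 * z\<^sup>2 - lam * z + C2)"
      using f form1_imp_ode form2_imp_ode(1) form5_imp_ode ad
      by (intro invariant_under_quadraticI [OF assms(1,3) ad]) (use assms(1) in \<open>elim disjE; simp\<close>)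
    moreover have "\<beta> \<noteq> 0 \<or> C1 * z0\<^sup>2 - lam * z0 + C2 \<noteq> 0"
      using f form2_imp_ode(2) [OF assms(1) _ z0] by (auto simp: form1_def form5_def)
    ultimately show ?thesis
      using z0 by (intro exI [of _ \<alpha>] exI [of _ \<beta>] exI [of _ "\<lambda>z. C1 * z\<^sup>2 - lam * z + C2"]) auto
  qed
  then show ?thesis
    unfolding noninvariant_solution_def fst_sol_domain by blast
qed

subsection \<open>Classification of the invariant solutions\<close>

text \<open>Identity theorem: f vanishes on the nonempty open set where a does not. It is applied
  with f = b'.\<close>

lemma product_zero_imp_deriv_zero:
  assumes "open D" "connected D" "a holomorphic_on D" "f holomorphic_on D"
    and "\<And>z. z \<in> D \<Longrightarrow> a z * f z = 0" "z0 \<in> D" "a z0 \<noteq> 0" "z \<in> D"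
  shows "f z = 0"
proof -
  have "{z \<in> D. 0 + a z \<noteq> 0} \<subseteq> D" "open {z \<in> D. 0 + a z \<noteq> 0}" "z0 \<in> {z \<in> D. 0 + a z \<noteq> 0}"
    using assms open_translate_nonzero [OF assms(1,3), of 0] by auto
  then show ?thesis
    using analytic_continuation_open [of "{z \<in> D. 0 + a z \<noteq> 0}" D f "\<lambda>_. 0" z] assms
    by auto
qed

text \<open>The residual is holomorphic with zero real part, hence an imaginary constant. Were it
  nonzero, b would be real at every point and therefore constant.\<close>

lemma nonconstant_invariant_imp_ode:
  assumes "open D" "connected D" "b holomorphic_on D" "\<not> form8 D b"
    and inv: "invariant_under (sol_domain D b) (sol b) \<alpha> \<beta> a" and "z \<in> D"
  shows "ode_residual b \<alpha> \<beta> a z = 0"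
proof -
  have "a holomorphic_on D"
    using inv unfolding invariant_under_sol_iff [OF assms(1,3)] by blast
  then have "ode_residual b \<alpha> \<beta> a holomorphic_on D"
    unfolding ode_residual_def [abs_def] using assms by (intro holomorphic_intros)
  from Re_zero_imp_constant [OF assms(1,2) this invariant_under_sol_imp(2) [OF assms(1,3) inv]]
  obtain c where c: "\<And>w. w \<in> D \<Longrightarrow> ode_residual b \<alpha> \<beta> a w = c"
    by blast
  have "Re c = 0"
    using c invariant_under_sol_imp(2) [OF assms(1,3) inv \<open>z \<in> D\<close>] \<open>z \<in> D\<close> by simp
  moreover have "Im c = 0"
  proof (rule ccontr)
    assume "Im c \<noteq> 0"
    then have "Re (\<i> * b w) = 0" if "w \<in> D" for w
      using invariant_under_sol_imp(3) [OF assms(1,3) inv that] c [OF that] by simp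
    moreover have "(\<lambda>w. \<i> * b w) holomorphic_on D"
      using assms(3) by (intro holomorphic_intros)
    ultimately have "\<exists>k. \<forall>w\<in>D. \<i> * b w = k"
      using Re_zero_imp_constant [OF assms(1,2), of "\<lambda>w. \<i> * b w"] by simp
    then obtain k where k: "\<And>w. w \<in> D \<Longrightarrow> \<i> * b w = k"
      by blast
    then have "b w = k / \<i>" if "w \<in> D" for w
      using k [OF that] by auto
    then show False
      using assms(4) unfolding form8_def by blast
  qed
  ultimately show ?thesis
    using c [OF \<open>z \<in> D\<close>] by (simp add: complex_eq_iff)
qed

text \<open>For \<beta> = 0, b is itself, up to a factor, the primitive that defines the logarithm.
  For \<beta> nonzero the equation becomes a h' = \<beta> h, and h is an imaginary power. In both
  cases C1 decides between linear and quadratic a.\<close>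

lemma invariant_imp_listed_or_log_form:
  assumes "open D" "connected D" "D \<noteq> {}" "b holomorphic_on D"
    and inv: "invariant_under (sol_domain D b) (sol b) \<alpha> \<beta> a"
    and nontriv: "\<not> (\<alpha> = 0 \<and> \<beta> = 0 \<and> (\<forall>z\<in>D. a z = 0))"
  shows "listed_form D b \<or> log_form D b"
proof (cases "form8 D b")
  case True
  then show ?thesis
    by (simp add: listed_form_def)
next
  case False
  have hol: "a holomorphic_on D"
    using inv unfolding invariant_under_sol_iff [OF assms(1,4)] by blast
  have kill: "spherical_killing a z" if "z \<in> D" for z
    using invariant_under_sol_imp(1) [OF assms(1,4) inv that] .
  obtain C1 lam C2 where ad: "admissible C1 lam C2"
    and a: "\<And>z. z \<in> D \<Longrightarrow> a z = C1 * z\<^sup>2 - lam * z + C2"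
    using spherical_killing_imp_quadratic [OF assms(1,2) hol kill] by blast
  have ode: "a z * deriv b z = \<beta> * b z - \<alpha>" if "z \<in> D" for z
    using nonconstant_invariant_imp_ode [OF assms(1,2,4) False inv that]
    by (simp add: ode_residual_def algebra_simps)
  have b': "(b has_field_derivative deriv b z) (at z)" if "z \<in> D" for z
    using that assms(1,4) holomorphic_derivI by blast
  have C2: "C2 = 0" if "C1 = 0"
    using ad that by (simp add: admissible_def)
  have lam: "Re lam = 0"
    using ad by (simp add: admissible_def complex_eq_iff)
  obtain z0 where z0: "z0 \<in> D"
    using assms(3) by blast
  show ?thesis
  proof (cases "\<beta> = 0")
    case \<beta>: True
    \<comment> \<open>Otherwise a b' = 0 with a not identically zero, which makes b
      constant.\<close>
    have "\<alpha> \<noteq> 0"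
    proof
      assume "\<alpha> = 0"
      then obtain z1 where "z1 \<in> D" "a z1 \<noteq> 0"
        using \<beta> nontriv by blast
      then have "deriv b z = 0" if "z \<in> D" for z
        using product_zero_imp_deriv_zero [OF assms(1,2) hol holomorphic_deriv [OF assms(4,1)] _ _ _ that]
          ode \<beta> \<open>\<alpha> = 0\<close> by auto
      then show False
        using deriv_zero_imp_constant [OF assms(1,2,4)] False by (simp add: form8_def)
    qed
    have anz: "a z \<noteq> 0" if "z \<in> D" for z
      using ode [OF that] \<beta> \<open>\<alpha> \<noteq> 0\<close> by auto
    have db: "deriv b z = - (\<alpha> / a z)" if "z \<in> D" for z
    proof -
      have "deriv b z = (a z * deriv b z) / a z"
        using anz [OF that] by simp
      then show ?thesis
        unfolding ode [OF that] \<beta> by simp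
    qed
    show ?thesis
    proof (cases "C1 = 0")
      case True
      have nz: "lam \<noteq> 0" "z \<noteq> 0" if "z \<in> D" for z
        using anz [OF that] a [OF that] True C2 by auto
      \<comment> \<open>Here a = - lam z, so b' = \<alpha> / (lam z). This branch produces the
        logarithm missing from the list.\<close>
      have "((\<lambda>z. lam / \<alpha> * b z) has_field_derivative 1 / z) (at z)" if "z \<in> D" for z
        using nz [OF that] \<open>\<alpha> \<noteq> 0\<close> a [OF that] True C2 db [OF that]
        by (auto intro!: derivative_eq_intros b' that)
      then obtain k where k: "log_branch D (\<lambda>z. z) (\<lambda>z. lam / \<alpha> * b z - k)"
        using log_branch_of_primitive [OF assms(1,2) nz(2) DERIV_ident] by blast
      have "b z = \<alpha> / lam * (lam / \<alpha> * b z - k) + \<alpha> / lam * k" for z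
        using nz [OF z0] \<open>\<alpha> \<noteq> 0\<close> by (simp add: field_simps)
      then have "log_form D b"
        unfolding log_form_def using \<open>\<alpha> \<noteq> 0\<close> nz [OF z0] ad k unfolding admissible_def by blast
      then show ?thesis ..
    next
      case False
      obtain \<nu> \<sigma> where r: "roots C1 (C2t C1 lam C2) \<nu> \<sigma>"
        using roots_exist [OF False] by blast
      have \<sigma>: "\<sigma> \<noteq> 0"
        using roots_imaginary(2) [OF ad False r] .
      have nz: "z + lamt C1 lam - \<nu> \<noteq> 0" "z + lamt C1 lam + \<nu> \<noteq> 0" if "z \<in> D" for z
        using anz [OF that] a [OF that] roots_factor [OF False r] by auto
      define g where "g z = (z + lamt C1 lam + \<nu>) / (z + lamt C1 lam - \<nu>)" for z
      have gnz: "g z \<noteq> 0" if "z \<in> D" for z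
        using nz [OF that] by (simp add: g_def)
      have g': "(g has_field_derivative - 2 * \<sigma> / a z * g z) (at z)" if "z \<in> D" for z
        unfolding g_def [abs_def] a [OF that]
        using has_field_derivative_root_quotient(2) [OF False r nz [OF that]] .
      have "((\<lambda>z. 2 * \<sigma> / \<alpha> * b z) has_field_derivative (- 2 * \<sigma> / a z * g z) / g z) (at z)" if "z \<in> D" for z
        using gnz [OF that] \<open>\<alpha> \<noteq> 0\<close> db [OF that]
        by (auto intro!: derivative_eq_intros b' that)
      then obtain k where k: "log_branch D g (\<lambda>z. 2 * \<sigma> / \<alpha> * b z - k)"
        using log_branch_of_primitive [OF assms(1,2) gnz g'] by blast
      have "b z = \<alpha> / (2 * \<sigma>) * (2 * \<sigma> / \<alpha> * b z - k) + \<alpha> / (2 * \<sigma>) * k" for z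
        using \<sigma> \<open>\<alpha> \<noteq> 0\<close> by (simp add: field_simps)
      then have "form2 D b \<alpha> \<beta> C1 lam C2"
        unfolding form2_def using \<beta> False C2t_nonzero [OF ad False] r k unfolding g_def by blast
      then show ?thesis
        unfolding listed_form_def using ad by blast
    qed
  next
    case \<beta>: False
    \<comment> \<open>Subtracting the constant solution \<alpha> / \<beta> makes the equation
      homogeneous.\<close>
    define h where "h z = b z - of_real (\<alpha> / \<beta>)" for z
    have h': "(h has_field_derivative deriv b z) (at z)" if "z \<in> D" for z
      unfolding h_def by (auto intro!: derivative_eq_intros b' that)
    have h_ode: "a z * deriv b z = \<beta> * h z" if "z \<in> D" for z
      using ode [OF that] \<beta> by (simp add: h_def right_diff_distrib)
    have hhol: "h holomorphic_on D"
      unfolding h_def by (intro holomorphic_intros assms)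
    have "\<not> h constant_on D"
    proof
      assume "h constant_on D"
      then obtain c where "\<And>z. z \<in> D \<Longrightarrow> h z = c"
        unfolding constant_on_def by blast
      then have "b z = c + of_real (\<alpha> / \<beta>)" if "z \<in> D" for z
        using that by (simp add: h_def algebra_simps)
      then show False
        using \<open>\<not> form8 D b\<close> unfolding form8_def by blast
    qed
    \<comment> \<open>Zero-freeness of h passes to a through a b' = \<beta> h, so the linear factors
      of a may be divided by.\<close>
    then have hnz: "h z \<noteq> 0" if "z \<in> D" for z
      using euler_ode_solution_nonzero [OF assms(1,2) hhol hol _ \<beta> kill _ that]
        h_ode DERIV_imp_deriv [OF h'] by metis
    have anz: "a z \<noteq> 0" if "z \<in> D" for z
      using h_ode [OF that] hnz [OF that] \<beta> by auto
    have h_log: "(h has_field_derivative \<beta> / a z * h z) (at z)" if "z \<in> D" for z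
    proof -
      have "deriv b z = \<beta> / a z * h z"
        using h_ode [OF that] anz [OF that] by (simp add: field_simps)
      then show ?thesis
        using h' [OF that] by simp
    qed
    have b_eq: "b z = h z + of_real (\<alpha> / \<beta>)" for z
      by (simp add: h_def)
    show ?thesis
    proof (cases "C1 = 0")
      case True
      have nz: "lam \<noteq> 0" "z \<noteq> 0" if "z \<in> D" for z
        using anz [OF that] a [OF that] True C2 by auto
      have gnz: "- lam * z + C2 \<noteq> 0" if "z \<in> D" for z
        using nz that True C2 by simp
      have g': "((\<lambda>z. - lam * z + C2) has_field_derivative - lam) (at z)" for z
        by (auto intro!: derivative_eq_intros)
      have hd: "(h has_field_derivative \<beta> / (- lam) * (- lam / (- lam * z + C2)) * h z) (at z)" if "z \<in> D" for z
        using h_log [OF that] a [OF that] True nz [OF z0] by simp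
      have \<gamma>: "Re (\<beta> / (- lam)) = 0" "\<beta> / (- lam) \<noteq> 0"
        using \<beta> lam nz [OF z0] by (simp_all add: Re_divide)
      obtain L C where "log_branch D (\<lambda>z. - lam * z + C2) L"
        "\<And>z. z \<in> D \<Longrightarrow> h z = C * exp (\<beta> / (- lam) * L z)"
        using log_branch_of_imaginary_power
          [OF assms(1,2) \<gamma>, of "\<lambda>z. - lam * z + C2" h "\<lambda>z. - lam", OF gnz hnz g' hd] by blast
      then have "form5 D b \<alpha> \<beta> C1 lam C2"
        unfolding form5_def using \<beta> True nz(1) [OF z0] b_eq by metis
      then show ?thesis
        unfolding listed_form_def using ad by blast
    next
      case False
      obtain \<nu> \<sigma> where r: "roots C1 (C2t C1 lam C2) \<nu> \<sigma>"
        using roots_exist [OF False] by blast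
      note \<sigma> = roots_imaginary [OF ad False r]
      have nz: "z + lamt C1 lam - \<nu> \<noteq> 0" "z + lamt C1 lam + \<nu> \<noteq> 0" if "z \<in> D" for z
        using anz [OF that] a [OF that] roots_factor [OF False r] by auto
      define g where "g z = (z + lamt C1 lam - \<nu>) / (z + lamt C1 lam + \<nu>)" for z
      have gnz: "g z \<noteq> 0" if "z \<in> D" for z
        using nz [OF that] by (simp add: g_def)
      have g': "(g has_field_derivative 2 * \<sigma> / a z * g z) (at z)" if "z \<in> D" for z
        unfolding g_def [abs_def] a [OF that]
        using has_field_derivative_root_quotient(1) [OF False r nz [OF that]] .
      have hd: "(h has_field_derivative \<beta> / (2 * \<sigma>) * (2 * \<sigma> / a z * g z / g z) * h z) (at z)" if "z \<in> D" for z
        using h_log [OF that] \<sigma> gnz [OF that] by simp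
      have \<gamma>: "Re (\<beta> / (2 * \<sigma>)) = 0" "\<beta> / (2 * \<sigma>) \<noteq> 0"
        using \<beta> \<sigma> by (simp_all add: Re_divide)
      obtain L C where "log_branch D g L"
        "\<And>z. z \<in> D \<Longrightarrow> h z = C * exp (\<beta> / (2 * \<sigma>) * L z)"
        using log_branch_of_imaginary_power
          [OF assms(1,2) \<gamma>, of g h "\<lambda>z. 2 * \<sigma> / a z * g z", OF gnz hnz g' hd] by blast
      then have "log_branch D g L \<and>
          (\<forall>z\<in>D. b z = C * exp (\<beta> / (2 * \<sigma>) * L z) + of_real (\<alpha> / \<beta>))"
        by (simp add: b_eq)
      then have "form1 D b \<alpha> \<beta> C1 lam C2"
        unfolding form1_def using \<beta> False C2t_nonzero [OF ad False] r unfolding g_def by blast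
      then show ?thesis
        unfolding listed_form_def using ad by blast
    qed
  qed
qed

section \<open>The equivalence and the generators of the eight forms\<close>

theorem theorem3:
  fixes D :: "complex set" and b :: "complex \<Rightarrow> complex"
  assumes "open D" and "connected D" and "D \<noteq> {}" and "b holomorphic_on D"
  shows
    "heavenly_solution (-1) (sol_domain D b) (sol b) \<and>
     (\<not> log_form D b \<longrightarrow>
       (noninvariant_solution (-1) (sol_domain D b) (sol b) \<longleftrightarrow> \<not> listed_form D b)) \<and>
     (\<forall>\<alpha> \<beta> C1 lam C2. admissible C1 lam C2 \<longrightarrow>
       (form1 D b \<alpha> \<beta> C1 lam C2 \<or> form2 D b \<alpha> \<beta> C1 lam C2 \<or>
        form3 D b \<alpha> \<beta> C1 lam C2 \<or> form4 D b \<alpha> \<beta> C1 lam C2 \<longrightarrow>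
          invariant_under (sol_domain D b) (sol b) \<alpha> \<beta>
            (\<lambda>z. C1 * (z + lamt C1 lam)\<^sup>2 + C2t C1 lam C2)) \<and>
       (form5 D b \<alpha> \<beta> C1 lam C2 \<longrightarrow>
          invariant_under (sol_domain D b) (sol b) \<alpha> \<beta> (\<lambda>z. - lam * z + C2)) \<and>
       (form6 D b \<alpha> \<beta> C1 lam C2 \<or> form7 D b \<alpha> \<beta> C1 lam C2 \<longrightarrow>
          invariant_under (sol_domain D b) (sol b) \<alpha> \<beta> (\<lambda>z. C2)) \<and>
       (form8 D b \<longrightarrow>
          invariant_under (sol_domain D b) (sol b) 0 0 (\<lambda>z. C1 * z\<^sup>2 - lam * z + C2)) \<and>
       (\<beta> \<noteq> 0 \<and> (\<forall>z\<in>D. b z = of_real (\<alpha> / \<beta>)) \<longrightarrow>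
          invariant_under (sol_domain D b) (sol b) \<alpha> \<beta> (\<lambda>z. 0)))"
proof (intro conjI impI allI)
  show sol: "heavenly_solution (-1) (sol_domain D b) (sol b)"
    by (rule heavenly_solution_sol [OF assms(1,4)])
  show "noninvariant_solution (-1) (sol_domain D b) (sol b) \<longleftrightarrow> \<not> listed_form D b"
    if "\<not> log_form D b"
  proof
    show "\<not> listed_form D b" if "noninvariant_solution (-1) (sol_domain D b) (sol b)"
      using that listed_form_imp_not_noninvariant [OF assms(1,3,4)] by blast
    show "noninvariant_solution (-1) (sol_domain D b) (sol b)" if "\<not> listed_form D b"
      unfolding noninvariant_solution_def fst_sol_domain
      using sol invariant_imp_listed_or_log_form [OF assms] that \<open>\<not> log_form D b\<close> by blast
  qed
  fix \<alpha> \<beta> C1 lam C2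
  assume ad: "admissible C1 lam C2"
  note I = invariant_under_quadraticI [OF assms(1,4) ad]
  show "invariant_under (sol_domain D b) (sol b) \<alpha> \<beta> (\<lambda>z. C1 * (z + lamt C1 lam)\<^sup>2 + C2t C1 lam C2)"
    if "form1 D b \<alpha> \<beta> C1 lam C2 \<or> form2 D b \<alpha> \<beta> C1 lam C2 \<or>
        form3 D b \<alpha> \<beta> C1 lam C2 \<or> form4 D b \<alpha> \<beta> C1 lam C2"
  proof -
    have f: "form1 D b \<alpha> \<beta> C1 lam C2 \<or> form2 D b \<alpha> \<beta> C1 lam C2"
      using that forms_3_4_6_7_impossible [OF ad] by blast
    then have "C1 \<noteq> 0"
      by (auto simp: form1_def form2_def)
    then show ?thesis
      unfolding complete_square [OF \<open>C1 \<noteq> 0\<close>]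
      using f form1_imp_ode [OF assms(1)] form2_imp_ode(1) [OF assms(1)] by (intro I) blast
  qed
  show "invariant_under (sol_domain D b) (sol b) \<alpha> \<beta> (\<lambda>z. - lam * z + C2)"
    if f: "form5 D b \<alpha> \<beta> C1 lam C2"
    using I [OF form5_imp_ode [OF assms(1) ad f]] f by (simp add: form5_def)
  show "invariant_under (sol_domain D b) (sol b) \<alpha> \<beta> (\<lambda>z. C2)"
    if "form6 D b \<alpha> \<beta> C1 lam C2 \<or> form7 D b \<alpha> \<beta> C1 lam C2"
    using that forms_3_4_6_7_impossible [OF ad] by blast
  show "invariant_under (sol_domain D b) (sol b) 0 0 (\<lambda>z. C1 * z\<^sup>2 - lam * z + C2)" if "form8 D b"
    using I form8_imp_ode [OF assms(1) that] by blast
  show "invariant_under (sol_domain D b) (sol b) \<alpha> \<beta> (\<lambda>z. 0)"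
    if "\<beta> \<noteq> 0 \<and> (\<forall>z\<in>D. b z = of_real (\<alpha> / \<beta>))"
    by (rule invariant_under_solI [OF assms(1,4)])
       (use that in \<open>auto simp: ode_residual_def spherical_killing_def\<close>)
qed

end
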